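(* Let $p\ge1$ be an integer and $\lambda>\sqrt{\frac{p+2}{p}}$. There exists a constant $c_{p,\lambda}>0$ such that the following holds. Let $\psi>0$ be a $\frac{2\pi}{\lambda}$-periodic function satisfying $$\frac{\lambda}{2\pi}\int_0^{\frac{2\pi}{\lambda}}\psi(\theta)\,d\theta\ \ge\ c_{p,\lambda}\|\psi\|_2 ,$$ let $k$ be the solution, with blow-up time $T$, of $$\frac{\partial k}{\partial t}=k^2\left(k^{p-1}k_{\theta\theta}+(p-1)k^{p-2}k_\theta^2+\frac1pk^p\right)\ \text{in }\left[0,\tfrac{2\pi}{\lambda}\right]\times(0,T),\qquad k(\cdot,0)=\psi,$$ with periodic boundary conditions, and let $u(\theta,\tau)$, $\tau\in[0,\infty)$, be the corresponding normalized solution $$u(\theta,\tau)=\left(\frac{p+1}{p}\right)^{\frac1{p+1}}(T-t)^{\frac1{p+1}}k(\theta,t),\qquad \tau=-\frac1{p+1}\log\left(1-\frac tT\right).$$ Then there is a constant $C>0$, depending on $\psi$, $p$ and $\lambda$, such that for all $\tau\ge0$ $$\|u(\cdot,\tau)-1\|_{L^\infty\left[0,\frac{2\pi}{\lambda}\right]}\le C\exp\left(-(\lambda^2p-p-1)\tau\right).$$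
   Context: For $f\in L^2([0,2\pi/\lambda])$ with Fourier expansion $\sum_{n\in\mathbb Z}\hat f(n)e^{i\lambda n\theta}$, define $\|f\|_2=\max\{\sup_{n\ne0}|n|^2|\mathrm{Re}\,\hat f(n)|,\sup_{n\ne0}|n|^2|\mathrm{Im}\,\hat f(n)|\}$ (not the $L^2$ norm), assumed finite for $\psi$. The solution $k$ is the positive classical solution on its maximal existence interval $[0,T)$; since $\psi>0$, it blows up in finite time $T\in(0,\infty)$. *)

theory Defs
  imports "HOL-Probability.Probability"
begin

definition period :: "real \<Rightarrow> real"
  where "period lam = 2 * pi / lam"

definition periodic_with :: "real \<Rightarrow> (real \<Rightarrow> real) \<Rightarrow> bool"
  where "periodic_with L f \<longleftrightarrow> (\<forall>x. f (x + L) = f x)"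

definition mean_value :: "real \<Rightarrow> (real \<Rightarrow> real) \<Rightarrow> real"
  where "mean_value lam f = lam / (2 * pi) * integral {0..period lam} f"

definition fourier_coeff :: "real \<Rightarrow> (real \<Rightarrow> real) \<Rightarrow> int \<Rightarrow> complex"
  where "fourier_coeff lam f n =
    complex_of_real (lam / (2 * pi)) *
      integral {0..period lam}
        (\<lambda>\<theta>. complex_of_real (f \<theta>) * exp (- (\<i> * complex_of_real (lam * of_int n * \<theta>))))"

text \<open>The suprema are taken in the extended reals, so the value is \<open>\<infinity>\<close> when the weighted
  coefficients are unbounded.\<close>

definition fourier_norm2 :: "real \<Rightarrow> (real \<Rightarrow> real) \<Rightarrow> ereal"
  where "fourier_norm2 lam f =
    max (SUP n\<in>{n. n \<noteq> 0}. ereal (of_int (\<bar>n\<bar>\<^sup>2) * \<bar>Re (fourier_coeff lam f n)\<bar>))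
        (SUP n\<in>{n. n \<noteq> 0}. ereal (of_int (\<bar>n\<bar>\<^sup>2) * \<bar>Im (fourier_coeff lam f n)\<bar>))"

text \<open>Periodic boundary conditions are expressed by extending the spatial variable periodically to
  the whole line. The solution is continuous up to time \<open>0\<close>, and \<open>C\<^sup>2\<close> in space and \<open>C\<^sup>1\<close> in time
  for positive times; in particular the initial function is continuous.
  Here \<open>k1\<close> is the derivative in space, \<open>k2\<close> the second derivative in space and \<open>kt\<close> the
  derivative in time. The integer power is used because the exponent \<open>p - 2\<close> is negative
  for \<open>p = 1\<close>.\<close>

definition classical_solution ::
  "nat \<Rightarrow> real \<Rightarrow> (real \<Rightarrow> real) \<Rightarrow> real \<Rightarrow> (real \<Rightarrow> real \<Rightarrow> real) \<Rightarrow> bool"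
  where "classical_solution p lam \<psi> T k \<longleftrightarrow>
    (\<forall>t\<in>{0..<T}. periodic_with (period lam) (\<lambda>\<theta>. k \<theta> t)) \<and>
    (\<forall>\<theta>. \<forall>t\<in>{0..<T}. 0 < k \<theta> t) \<and>
    continuous_on (UNIV \<times> {0..<T}) (\<lambda>(\<theta>, t). k \<theta> t) \<and>
    (\<forall>\<theta>. k \<theta> 0 = \<psi> \<theta>) \<and>
    (\<exists>k1 k2 kt.
      continuous_on (UNIV \<times> {0<..<T}) (\<lambda>(\<theta>, t). k1 \<theta> t) \<and>
      continuous_on (UNIV \<times> {0<..<T}) (\<lambda>(\<theta>, t). k2 \<theta> t) \<and>
      continuous_on (UNIV \<times> {0<..<T}) (\<lambda>(\<theta>, t). kt \<theta> t) \<and>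
      (\<forall>\<theta>. \<forall>t\<in>{0<..<T}.
        ((\<lambda>x. k x t) has_real_derivative k1 \<theta> t) (at \<theta>) \<and>
        ((\<lambda>x. k1 x t) has_real_derivative k2 \<theta> t) (at \<theta>) \<and>
        ((\<lambda>s. k \<theta> s) has_real_derivative kt \<theta> t) (at t) \<and>
        kt \<theta> t = (k \<theta> t)\<^sup>2 *
          (k \<theta> t powi (int p - 1) * k2 \<theta> t
           + (real p - 1) * k \<theta> t powi (int p - 2) * (k1 \<theta> t)\<^sup>2
           + 1 / real p * k \<theta> t ^ p)))"

definition maximal_solution ::
  "nat \<Rightarrow> real \<Rightarrow> (real \<Rightarrow> real) \<Rightarrow> real \<Rightarrow> (real \<Rightarrow> real \<Rightarrow> real) \<Rightarrow> bool"
  where "maximal_solution p lam \<psi> T k \<longleftrightarrow>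
    0 < T \<and> classical_solution p lam \<psi> T k \<and>
    \<not> (\<exists>T' k'. T < T' \<and> classical_solution p lam \<psi> T' k' \<and>
          (\<forall>\<theta>. \<forall>t\<in>{0..<T}. k' \<theta> t = k \<theta> t))"

text \<open>A classical solution is bounded on \<open>[0, S]\<close> for every \<open>S < T\<close>, so unboundedness on \<open>[0, T)\<close>
  means blow-up as \<open>t\<close> tends to \<open>T\<close>.\<close>

definition blows_up_at :: "real \<Rightarrow> (real \<Rightarrow> real \<Rightarrow> real) \<Rightarrow> bool"
  where "blows_up_at T k \<longleftrightarrow> \<not> bdd_above ((\<lambda>(\<theta>, t). k \<theta> t) ` (UNIV \<times> {0..<T}))"

definition rescaled_time :: "nat \<Rightarrow> real \<Rightarrow> real \<Rightarrow> real"
  where "rescaled_time p T t = - (1 / (real p + 1)) * ln (1 - t / T)"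

text \<open>Since \<^term>\<open>rescaled_time p T\<close> maps \<open>[0, T)\<close> bijectively onto \<open>[0, \<infinity>)\<close>, this determines
  \<open>u \<theta> \<tau>\<close> for all \<open>\<tau> \<ge> 0\<close>.\<close>

definition normalized_solution ::
  "nat \<Rightarrow> real \<Rightarrow> (real \<Rightarrow> real \<Rightarrow> real) \<Rightarrow> (real \<Rightarrow> real \<Rightarrow> real) \<Rightarrow> bool"
  where "normalized_solution p T k u \<longleftrightarrow>
    (\<forall>\<theta>. \<forall>t\<in>{0..<T}. u \<theta> (rescaled_time p T t) =
      ((real p + 1) / real p) powr (1 / (real p + 1)) *
      (T - t) powr (1 / (real p + 1)) * k \<theta> t)"

definition Linfty_norm :: "real set \<Rightarrow> (real \<Rightarrow> real) \<Rightarrow> ereal"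
  where "Linfty_norm S f = esssup (lebesgue_on S) (\<lambda>x. ereal \<bar>f x\<bar>)"

end

theory Submission
  imports Defs
begin

text \<open>Put \<open>v = k\<^sup>p\<close> and \<open>q = (p + 1) / p\<close>; then \<open>v\<^sub>t = v\<^sup>q (v'' + v)\<close>, and the spatially constant solution that
  blows up at \<open>T\<close> is \<open>Y(t) = (q (T - t))\<^bsup>-1/q\<^esup>\<close>. Comparison with constant solutions shows that \<open>v\<close> takes at
  every time values on both sides of \<open>Y\<close>. This disposes of the only unstable mode: the
  distance of \<open>v\<close> from \<open>Y\<close> is at most the oscillation of \<open>v\<close>, so it suffices to control the oscillation.

  For this a maximum principle is applied to \<open>v(x + 2s) - v(x) - 2 A(t) sin(\<lambda>s)\<^sup>\<alpha>\<close> with \<open>0 \<le> s \<le> \<pi>/\<lambda>\<close>.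
  The modulus is a supersolution when \<open>A' \<ge> A ((1 + q) v(y)\<^sup>q - \<alpha> \<lambda>\<^sup>2 v(x)\<^sup>q)\<close>. Writing \<open>A = Y B\<close>, this
  becomes a linear inequality for \<open>B\<close> with decay rate \<open>\<alpha> \<lambda>\<^sup>2 - q\<close>, up to an error of the size of the
  relative oscillation. It is used twice. First with \<open>\<alpha> = (p + 1) / (p + 2)\<close>: since
  \<open>\<lambda>\<^sup>2 > (p + 2) / p\<close>, the rate is positive, and since \<open>\<alpha> < 1\<close>, Fourier coefficients of size
  \<open>\<parallel>\<psi>\<parallel>\<^sub>2 / n\<^sup>2\<close> make the initial modulus a small multiple of \<open>sin(\<lambda>s)\<^sup>\<alpha>\<close>; hence the oscillation
  decays at some positive rate. Then with \<open>\<alpha> = 1\<close> from a positive time on, where \<open>v\<close> is Lipschitz: the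
  error term is now integrable, and the exact rate \<open>\<lambda>\<^sup>2 - q\<close> results.\<close>

section \<open>From Fourier decay to a Hoelder modulus\<close>

lemma sin_nat_mult_le: "\<bar>sin (real n * x)\<bar> \<le> real n * \<bar>sin x\<bar>"
proof (induction n)
  case (Suc n)
  have "\<bar>sin (real (Suc n) * x)\<bar> = \<bar>sin (real n * x) * cos x + cos (real n * x) * sin x\<bar>"
    by (simp add: sin_add distrib_right algebra_simps)
  also have "\<dots> \<le> \<bar>sin (real n * x)\<bar> * \<bar>cos x\<bar> + \<bar>cos (real n * x)\<bar> * \<bar>sin x\<bar>"
    by (metis abs_mult abs_triangle_ineq)
  also have "\<dots> \<le> \<bar>sin (real n * x)\<bar> * 1 + 1 * \<bar>sin x\<bar>"
    by (intro add_mono mult_mono) auto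
  also have "\<dots> \<le> real (Suc n) * \<bar>sin x\<bar>"
    using Suc by (simp add: distrib_right)
  finally show ?case .
qed auto

text \<open>Interpolation between the bounds 1 and \<open>|n| * |sin x|\<close>: a number in [0, 1]
  is at most its \<alpha>-th power. Losing only the factor \<open>|n| powr \<alpha>\<close> leaves a
  summable series when coefficients decay like \<open>n^-2\<close> and \<alpha> < 1.\<close>

lemma sin_int_mult_le_powr:
  assumes "0 < \<alpha>" "\<alpha> \<le> 1"
  shows "\<bar>sin (of_int n * x :: real)\<bar> \<le> \<bar>of_int n\<bar> powr \<alpha> * \<bar>sin x\<bar> powr \<alpha>"
proof -
  let ?s = "\<bar>sin (of_int n * x)\<bar>"
  have "?s = \<bar>sin (real (nat \<bar>n\<bar>) * x)\<bar>"
    by (cases "n \<ge> 0") (auto simp: abs_if)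
  also have "\<dots> \<le> real (nat \<bar>n\<bar>) * \<bar>sin x\<bar>" by (rule sin_nat_mult_le)
  finally have le: "?s \<le> \<bar>of_int n\<bar> * \<bar>sin x\<bar>" by simp
  have "?s powr 1 \<le> ?s powr \<alpha>"
    using assms by (intro powr_mono') auto
  hence "?s \<le> ?s powr \<alpha>" by simp
  also have "\<dots> \<le> (\<bar>of_int n\<bar> * \<bar>sin x\<bar>) powr \<alpha>"
    using assms le by (intro powr_mono2) auto
  finally show ?thesis by (simp add: powr_mult)
qed

text \<open>Chord length on the unit circle, from the law of cosines and the half-angle
  formula.\<close>

lemma norm_exp_i_diff: "norm (exp (\<i> * complex_of_real a) - exp (\<i> * complex_of_real b)) = 2 * \<bar>sin ((a - b) / 2)\<bar>"
proof -
  have "(norm (exp (\<i> * complex_of_real a) - exp (\<i> * complex_of_real b)))\<^sup>2 = (cos a - cos b)\<^sup>2 + (sin a - sin b)\<^sup>2"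
    by (simp add: cmod_power2 exp_Euler[symmetric] cis_conv_exp[symmetric] flip: cis_conv_exp)
  also have "\<dots> = 2 - 2 * cos (a - b)"
    using sin_cos_squared_add[of a] sin_cos_squared_add[of b]
    unfolding power2_diff cos_diff by (simp add: algebra_simps)
  also have "\<dots> = (2 * \<bar>sin ((a - b) / 2)\<bar>)\<^sup>2"
    using cos_double_sin[of "(a - b) / 2"] by (simp add: power_mult_distrib diff_divide_distrib)
  finally show ?thesis by (rule power2_eq_imp_eq) auto
qed

section \<open>Powers of the cosine as a convolution kernel\<close>

lemma cos_even_power_expansion:
  fixes y :: real
  shows "complex_of_real (4 ^ N * cos (y / 2) ^ (2 * N)) =
    (\<Sum>j\<le>2*N. of_nat (2*N choose j) * exp (\<i> * complex_of_real (of_int (int j - int N) * y)))"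
proof -
  define z where "z = exp (\<i> * complex_of_real (y / 2))"
  define w where "w = exp (- (\<i> * complex_of_real (y / 2)))"
  have "complex_of_real (2 * cos (y / 2)) = z + w"
    unfolding z_def w_def by (simp add: cos_exp_eq flip: cos_of_real)
  hence "complex_of_real (4 ^ N * cos (y / 2) ^ (2 * N)) = (z + w) ^ (2 * N)"
  proof -
    have "4 ^ N * cos (y / 2) ^ (2 * N) = (2 * cos (y / 2)) ^ (2 * N)"
      by (simp add: power_mult power_mult_distrib)
    thus ?thesis using \<open>_ = z + w\<close> by (metis of_real_power)
  qed
  \<comment> \<open>\<open>j\<close> factors of frequency 1/2 and \<open>2*N - j\<close> factors of
    frequency -1/2 add up to \<open>j - N\<close>; the even exponent makes every frequency an
    integer.\<close>
  also have "\<dots> = (\<Sum>j\<le>2*N. of_nat (2*N choose j) * z ^ j * w ^ (2*N - j))"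
    by (rule binomial_ring)
  also have "\<dots> = (\<Sum>j\<le>2*N. of_nat (2*N choose j) * exp (\<i> * complex_of_real (of_int (int j - int N) * y)))"
  proof (intro sum.cong refl)
    fix j assume j: "j \<in> {..2*N}"
    have "z ^ j * w ^ (2*N - j) = exp (of_nat j * (\<i> * complex_of_real (y / 2)) + of_nat (2*N - j) * (- (\<i> * complex_of_real (y / 2))))"
      unfolding z_def w_def exp_add by (simp only: exp_of_nat_mult)
    also have "of_nat j * (\<i> * complex_of_real (y / 2)) + of_nat (2*N - j) * (- (\<i> * complex_of_real (y / 2)))
        = \<i> * complex_of_real (of_int (int j - int N) * y)"
      using j by (simp add: of_nat_diff algebra_simps add_divide_distrib)
    finally show "of_nat (2*N choose j) * z ^ j * w ^ (2*N - j) =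
       of_nat (2*N choose j) * exp (\<i> * complex_of_real (of_int (int j - int N) * y))"
      by (simp add: mult.assoc)
  qed
  finally show ?thesis .
qed

text \<open>The kernel is a trigonometric polynomial, so convolution with it only weights the
  Fourier coefficients of \<open>g\<close> by binomial coefficients. The sum is finite, hence no
  convergence of the Fourier series of \<open>g\<close> enters.\<close>

lemma cos_power_convolution:
  assumes "continuous_on UNIV g"
  shows "complex_of_real (4 ^ N * (lam / (2 * pi) * integral {0..period lam} (\<lambda>\<theta>. g \<theta> * cos (lam * (x - \<theta>) / 2) ^ (2 * N)))) =
    (\<Sum>j\<le>2*N. of_nat (2*N choose j) * (fourier_coeff lam g (int j - int N) *
       exp (\<i> * complex_of_real (lam * of_int (int j - int N) * x))))"
proof -
  have cont: "continuous_on A g" for A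
    using assms continuous_on_subset by blast
  let ?e = "\<lambda>n \<theta>. complex_of_real (g \<theta>) * exp (- (\<i> * complex_of_real (lam * of_int n * \<theta>)))"
  let ?c = "\<lambda>j. of_nat (2*N choose j) * exp (\<i> * complex_of_real (lam * of_int (int j - int N) * x))"
  have int: "?e n integrable_on {0..period lam}" for n
    by (intro integrable_continuous_real continuous_intros cont)
  have "complex_of_real (4 ^ N * (g \<theta> * cos (lam * (x - \<theta>) / 2) ^ (2 * N))) =
      (\<Sum>j\<le>2*N. ?c j * ?e (int j - int N) \<theta>)" for \<theta>
  proof -
    have "complex_of_real (4 ^ N * (g \<theta> * cos (lam * (x - \<theta>) / 2) ^ (2 * N))) = complex_of_real (g \<theta>) * complex_of_real (4 ^ N * cos (lam * (x - \<theta>) / 2) ^ (2 * N))"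
      by simp
    also have "\<dots> = (\<Sum>j\<le>2*N. ?c j * ?e (int j - int N) \<theta>)"
      unfolding cos_even_power_expansion sum_distrib_left
    proof (intro sum.cong refl)
      fix j
      have "exp (\<i> * complex_of_real (of_int (int j - int N) * (lam * (x - \<theta>)))) = 
        exp (\<i> * complex_of_real (lam * of_int (int j - int N) * x)) * exp (- (\<i> * complex_of_real (lam * of_int (int j - int N) * \<theta>)))"
        unfolding exp_add[symmetric] by (simp add: algebra_simps)
      thus "complex_of_real (g \<theta>) * (of_nat (2*N choose j) * exp (\<i> * complex_of_real (of_int (int j - int N) * (lam * (x - \<theta>))))) = ?c j * ?e (int j - int N) \<theta>"
        by simp
    qed
    finally show ?thesis .
  qed
  hence "integral {0..period lam} (\<lambda>\<theta>. complex_of_real (4 ^ N * (g \<theta> * cos (lam * (x - \<theta>) / 2) ^ (2 * N)))) =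
    (\<Sum>j\<le>2*N. ?c j * integral {0..period lam} (?e (int j - int N)))"
    using int by (simp only: integral_sum[OF finite_atMost integrable_on_mult_right] integral_mult_right)
  moreover have "integral {0..period lam} (\<lambda>\<theta>. complex_of_real (4 ^ N * (g \<theta> * cos (lam * (x - \<theta>) / 2) ^ (2 * N)))) =
    complex_of_real (integral {0..period lam} (\<lambda>\<theta>. 4 ^ N * (g \<theta> * cos (lam * (x - \<theta>) / 2) ^ (2 * N))))"
  proof -
    have "(\<lambda>\<theta>. 4 ^ N * (g \<theta> * cos (lam * (x - \<theta>) / 2) ^ (2 * N))) integrable_on {0..period lam}"
      by (intro integrable_continuous_real continuous_intros cont) auto
    from integral_linear[OF this bounded_linear_of_real[where ?'a = complex]] show ?thesis
      by (simp add: o_def)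
  qed
  ultimately have "complex_of_real (4 ^ N * integral {0..period lam} (\<lambda>\<theta>. g \<theta> * cos (lam * (x - \<theta>) / 2) ^ (2 * N))) =
    (\<Sum>j\<le>2*N. ?c j * integral {0..period lam} (?e (int j - int N)))"
    by simp
  hence "complex_of_real (lam / (2 * pi)) * complex_of_real (4 ^ N * integral {0..period lam} (\<lambda>\<theta>. g \<theta> * cos (lam * (x - \<theta>) / 2) ^ (2 * N))) =
    complex_of_real (lam / (2 * pi)) * (\<Sum>j\<le>2*N. ?c j * integral {0..period lam} (?e (int j - int N)))"
    by simp
  thus ?thesis unfolding fourier_coeff_def sum_distrib_left by (simp add: mult_ac)
qed

lemma fourier_coeff_one:
  assumes "lam > 0"
  shows "fourier_coeff lam (\<lambda>_. 1) n = (if n = 0 then 1 else 0)"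
proof (cases "n = 0")
  case True
  thus ?thesis using assms by (simp add: fourier_coeff_def period_def scaleR_conv_of_real)
next
  case False
  let ?a = "- (\<i> * complex_of_real (lam * of_int n))"
  have a: "?a \<noteq> 0" using False assms by simp
  have "((\<lambda>\<theta>. exp (?a * complex_of_real \<theta>)) has_integral
      exp (?a * complex_of_real (period lam)) / ?a - exp (?a * complex_of_real 0) / ?a) {0..period lam}"
    using assms a
    by (intro fundamental_theorem_of_calculus)
      (auto simp: period_def intro!: derivative_eq_intros has_vector_derivative_real_field)
  moreover have "exp (?a * complex_of_real (period lam)) = 1"
  proof -
    have "?a * complex_of_real (period lam) = 2 * of_int (-n) * of_real pi * \<i>"
      using assms by (simp add: period_def)
    moreover have "exp (2 * of_int (-n) * of_real pi * \<i>) = 1"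
      using exp_integer_2pi[OF Ints_of_int[of "-n"]] by (simp add: mult.assoc)
    ultimately show ?thesis by (simp only:)
  qed
  ultimately have "integral {0..period lam} (\<lambda>\<theta>. exp (?a * complex_of_real \<theta>)) = 0"
    by (auto dest: integral_unique)
  thus ?thesis using False by (simp add: fourier_coeff_def mult.assoc)
qed

text \<open>The convolution formula for the constant function 1: only frequency 0, that is
  \<open>j = N\<close>, survives. This yields the normalizing constant of the kernel.\<close>

lemma cos_power_mean:
  assumes "lam > 0"
  shows "lam / (2 * pi) * integral {0..period lam} (\<lambda>\<theta>. cos (lam * (x - \<theta>) / 2) ^ (2 * N)) =
    real (2*N choose N) / 4 ^ N"
proof -
  have "complex_of_real (4 ^ N * (lam / (2 * pi) * integral {0..period lam} (\<lambda>\<theta>. 1 * cos (lam * (x - \<theta>) / 2) ^ (2 * N)))) =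
    (\<Sum>j\<le>2*N. if j = N then of_nat (2*N choose N) else 0)"
    by (subst cos_power_convolution)
      (auto simp del: of_int_diff simp: fourier_coeff_one[OF assms] if_distrib[of "\<lambda>c. c * _"] if_distrib[of "\<lambda>c. _ * c"] cong: if_cong)
  also have "\<dots> = complex_of_real (real (2*N choose N))"
    by (simp add: sum.delta)
  finally have "4 ^ N * (lam / (2 * pi) * integral {0..period lam} (\<lambda>\<theta>. cos (lam * (x - \<theta>) / 2) ^ (2 * N))) = real (2*N choose N)"
    by (simp only: of_real_eq_iff mult_1)
  thus ?thesis by (simp add: field_simps)
qed

text \<open>The de la Vallee-Poussin mean of \<open>g\<close>. Its Fourier multipliers lie between 0 and 1, and
  \<open>1 - cos\<^sup>2 = sin\<^sup>2\<close> lets one compute the second moment of the kernel in closed form, which gives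
  convergence by Korovkin's argument.\<close>

definition vallee_poussin_mean :: "real \<Rightarrow> (real \<Rightarrow> real) \<Rightarrow> nat \<Rightarrow> real \<Rightarrow> real"
  where "vallee_poussin_mean lam g N x = 4 ^ N / real (2*N choose N) *
    (lam / (2 * pi) * integral {0..period lam} (\<lambda>\<theta>. g \<theta> * cos (lam * (x - \<theta>) / 2) ^ (2 * N)))"

text \<open>Compares the normalizations of the kernels of orders \<open>N\<close> and
  \<open>Suc N\<close>, which differ by a factor cos^2; from it comes the mean of cos^2 under the
  kernel.\<close>

lemma central_binomial_ratio:
  "real (2 * Suc N choose Suc N) * real (Suc N) = 2 * real (2 * N + 1) * real (2*N choose N)"
proof -
  have 1: "Suc (2*N+1) * (2*N+1 choose N) = (Suc (2*N+1) choose Suc N) * Suc N"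
    by (rule Suc_times_binomial_eq)
  have 2: "Suc (2*N) * (2*N choose N) = (Suc (2*N) choose Suc N) * Suc N"
    by (rule Suc_times_binomial_eq)
  have 3: "(2*N+1 choose N) = (Suc (2*N) choose Suc N)"
    using binomial_symmetric[of N "2*N+1"] by simp
  have "(2 * Suc N choose Suc N) * Suc N = 2 * (2*N+1) * (2*N choose N)"
    using 1 2 3 by (simp add: algebra_simps)
  thus ?thesis by (metis of_nat_mult of_nat_numeral)
qed

lemma periodic_with_shift:
  assumes "periodic_with L g"
  shows "g (x + of_int i * L) = g x"
proof (induction i rule: int_induct[where k = 0])
  case (step1 i)
  have "g (x + of_int (i + 1) * L) = g ((x + of_int i * L) + L)"
    by (simp add: algebra_simps)
  thus ?case using assms step1 by (simp only: periodic_with_def)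
next
  case (step2 i)
  have "g (x + of_int i * L) = g ((x + of_int (i - 1) * L) + L)"
    by (simp add: algebra_simps)
  thus ?case using assms step2 by (simp only: periodic_with_def)
qed auto

text \<open>sin^2 vanishes only where \<theta> agrees with \<open>x\<close> modulo the period, and
  there \<open>g\<close> does not deviate. On the compact set where the deviation is at least
  \<epsilon>, sin^2 therefore has a positive minimum; dividing a bound for the deviation by it gives
  \<open>M\<close>.\<close>

lemma sin_sq_majorant:
  assumes "lam > 0" and cont: "continuous_on UNIV g" and per: "periodic_with (period lam) g" and "\<epsilon> > 0"
  shows "\<exists>M\<ge>0. \<forall>\<theta>\<in>{0..period lam}. \<bar>g \<theta> - g x\<bar> \<le> \<epsilon> + M * (sin (lam * (x - \<theta>) / 2))\<^sup>2"
proof -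
  define D where "D = {0..period lam} \<inter> {\<theta>. \<epsilon> \<le> \<bar>g \<theta> - g x\<bar>}"
  let ?s = "\<lambda>\<theta>. (sin (lam * (x - \<theta>) / 2))\<^sup>2"
  have pos: "?s \<theta> > 0" if "\<theta> \<in> D" for \<theta>
  proof (rule ccontr)
    assume "\<not> ?s \<theta> > 0"
    hence "sin (lam * (x - \<theta>) / 2) = 0" by simp
    then obtain i :: int where "lam * (x - \<theta>) / 2 = of_int i * pi"
      by (auto simp: sin_zero_iff_int2)
    hence "x = \<theta> + of_int i * period lam" using \<open>lam > 0\<close> by (simp add: period_def field_simps)
    hence "g x = g \<theta>" using periodic_with_shift[OF per] by simp
    thus False using that \<open>\<epsilon> > 0\<close> by (simp add: D_def)
  qed
  have "compact D" unfolding D_def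
    by (intro compact_Int_closed closed_Collect_le continuous_intros cont) auto
  have bdd: "\<exists>G. \<forall>\<theta>\<in>{0..period lam}. \<bar>g \<theta> - g x\<bar> \<le> G"
  proof -
    have "compact ((\<lambda>\<theta>. g \<theta> - g x) ` {0..period lam})"
      by (intro compact_continuous_image continuous_intros continuous_on_subset[OF cont]) auto
    from compact_imp_bounded[OF this] show ?thesis
      unfolding bounded_iff by auto
  qed
  then obtain G where G: "\<And>\<theta>. \<theta> \<in> {0..period lam} \<Longrightarrow> \<bar>g \<theta> - g x\<bar> \<le> G" by blast
  show ?thesis
  proof (cases "D = {}")
    case True
    hence "\<forall>\<theta>\<in>{0..period lam}. \<bar>g \<theta> - g x\<bar> \<le> \<epsilon> + 0 * ?s \<theta>"
      by (auto simp: D_def not_le intro: less_imp_le)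
    thus ?thesis by blast
  next
    case False
    obtain m where m: "m \<in> D" "\<And>\<theta>. \<theta> \<in> D \<Longrightarrow> ?s m \<le> ?s \<theta>"
    proof -
      have "continuous_on D ?s" by (intro continuous_intros) auto
      thus ?thesis using continuous_attains_inf[OF \<open>compact D\<close> False, of ?s] that by blast
    qed
    have "G \<ge> 0" using G[of m] m by (auto simp: D_def)
    show ?thesis
    proof (intro exI[of _ "G / ?s m"] conjI ballI)
      fix \<theta> assume \<theta>: "\<theta> \<in> {0..period lam}"
      show "\<bar>g \<theta> - g x\<bar> \<le> \<epsilon> + G / ?s m * ?s \<theta>"
      proof (cases "\<theta> \<in> D")
        case True
        have "G * 1 \<le> G * (?s \<theta> / ?s m)"
          using m(2)[OF True] pos[OF m(1)] \<open>G \<ge> 0\<close> by (intro mult_left_mono) auto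
        thus ?thesis using G[OF \<theta>] \<open>\<epsilon> > 0\<close> by simp
      next
        case False
        moreover have "0 \<le> G / ?s m * ?s \<theta>" using \<open>G \<ge> 0\<close> by simp
        ultimately show ?thesis using \<theta> by (simp add: D_def)
      qed
    qed (use \<open>G \<ge> 0\<close> in auto)
  qed
qed

lemma vallee_poussin_mean_tendsto:
  assumes "lam > 0" and cont: "continuous_on UNIV g" and per: "periodic_with (period lam) g"
  shows "(\<lambda>N. vallee_poussin_mean lam g N x) \<longlonglongrightarrow> g x"
proof (rule LIMSEQ_I)
  fix r :: real assume "r > 0"
  obtain M where M: "M \<ge> 0" "\<And>\<theta>. \<theta> \<in> {0..period lam} \<Longrightarrow> \<bar>g \<theta> - g x\<bar> \<le> r / 2 + M * (sin (lam * (x - \<theta>) / 2))\<^sup>2"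
    using sin_sq_majorant[OF assms, of "r / 2" x] \<open>r > 0\<close> by auto
  have cont': "continuous_on A g" for A
    using cont continuous_on_subset by blast
  have bound: "\<bar>vallee_poussin_mean lam g N x - g x\<bar> \<le> r / 2 + M / (2 * real N + 2)" for N
  proof -
    define c where "c = 4 ^ N / real (2*N choose N) * (lam / (2 * pi))"
    let ?k = "\<lambda>N \<theta>. cos (lam * (x - \<theta>) / 2) ^ (2 * N)"
    let ?I = "integral {0..period lam}"
    have "c > 0" using \<open>lam > 0\<close> by (simp add: c_def)
    have int: "(\<lambda>\<theta>. h \<theta> * ?k n \<theta>) integrable_on {0..period lam}" if "continuous_on {0..period lam} h" for h n
      using that by (intro integrable_continuous_real continuous_intros) auto
    have one: "c * ?I (?k N) = 1"
      using cos_power_mean[OF \<open>lam > 0\<close>, of x N] by (simp add: c_def field_simps)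
    \<comment> \<open>The mean of cos^2 under the normalized kernel. Its complement
      \<open>1 / (2 * N + 2)\<close> is the mean of sin^2, which tends to 0.\<close>
    have two: "c * ?I (?k (Suc N)) = (2 * real N + 1) / (2 * real N + 2)"
    proof -
      have "c * ?I (?k (Suc N)) = 4 ^ N / real (2*N choose N) * (lam / (2 * pi) * ?I (?k (Suc N)))"
        unfolding c_def by simp
      also have "\<dots> = 4 ^ N / real (2*N choose N) * (real (2 * Suc N choose Suc N) / 4 ^ Suc N)"
        unfolding cos_power_mean[OF \<open>lam > 0\<close>, of x "Suc N"] ..
      also have "real (2 * Suc N choose Suc N) = 2 * real (2 * N + 1) * real (2*N choose N) / real (Suc N)"
        unfolding central_binomial_ratio[symmetric] by simp
      also have "4 ^ N / real (2*N choose N) * (2 * real (2 * N + 1) * real (2*N choose N) / real (Suc N) / 4 ^ Suc N) = (2 * real N + 1) / (2 * real N + 2)"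
        by (simp add: divide_simps) (simp add: algebra_simps)
      finally show ?thesis .
    qed
    have "vallee_poussin_mean lam g N x - g x = c * ?I (\<lambda>\<theta>. g \<theta> * ?k N \<theta>) - c * ?I (\<lambda>\<theta>. g x * ?k N \<theta>)"
    proof -
      have "c * ?I (\<lambda>\<theta>. g x * ?k N \<theta>) = g x * (c * ?I (?k N))" by simp
      also have "\<dots> = g x" unfolding one by simp
      finally show ?thesis by (simp add: vallee_poussin_mean_def c_def)
    qed
    also have "\<dots> = c * ?I (\<lambda>\<theta>. (g \<theta> - g x) * ?k N \<theta>)"
      using int[of g N] int[of "\<lambda>_. g x" N]
      by (simp only: left_diff_distrib integral_diff cont' continuous_on_const right_diff_distrib)
    finally have eq: "vallee_poussin_mean lam g N x - g x = c * ?I (\<lambda>\<theta>. (g \<theta> - g x) * ?k N \<theta>)" .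
    have "\<bar>?I (\<lambda>\<theta>. (g \<theta> - g x) * ?k N \<theta>)\<bar> \<le> ?I (\<lambda>\<theta>. (r / 2 + M) * ?k N \<theta> - M * ?k (Suc N) \<theta>)"
    proof -
      have "norm (?I (\<lambda>\<theta>. (g \<theta> - g x) * ?k N \<theta>)) \<le> ?I (\<lambda>\<theta>. (r / 2 + M) * ?k N \<theta> - M * ?k (Suc N) \<theta>)"
      proof (rule integral_norm_bound_integral)
        show "(\<lambda>\<theta>. (g \<theta> - g x) * ?k N \<theta>) integrable_on {0..period lam}"
          by (intro int continuous_intros cont')
        show "(\<lambda>\<theta>. (r / 2 + M) * ?k N \<theta> - M * ?k (Suc N) \<theta>) integrable_on {0..period lam}"
          by (intro integrable_diff int continuous_intros)
        fix \<theta> assume "\<theta> \<in> {0..period lam}"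
        have "norm ((g \<theta> - g x) * ?k N \<theta>) = \<bar>g \<theta> - g x\<bar> * ?k N \<theta>"
          by (simp add: abs_mult)
        also have "\<dots> \<le> (r / 2 + M * (sin (lam * (x - \<theta>) / 2))\<^sup>2) * ?k N \<theta>"
          using M(2)[OF \<open>\<theta> \<in> _\<close>] by (intro mult_right_mono) auto
        also have "\<dots> = (r / 2 + M) * ?k N \<theta> - M * ?k (Suc N) \<theta>"
          unfolding sin_squared_eq by (simp add: algebra_simps power2_eq_square)
        finally show "norm ((g \<theta> - g x) * ?k N \<theta>) \<le> (r / 2 + M) * ?k N \<theta> - M * ?k (Suc N) \<theta>" .
      qed
      thus ?thesis by simp
    qed
    also have "\<dots> = (r / 2 + M) * ?I (?k N) - M * ?I (?k (Suc N))"
      using int[of "\<lambda>_. r / 2 + M" N] int[of "\<lambda>_. M" "Suc N"] by (simp add: integral_diff)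
    finally have "c * \<bar>?I (\<lambda>\<theta>. (g \<theta> - g x) * ?k N \<theta>)\<bar> \<le> c * ((r / 2 + M) * ?I (?k N) - M * ?I (?k (Suc N)))"
      using \<open>c > 0\<close> by (intro mult_left_mono) auto
    also have "\<dots> = (r / 2 + M) * (c * ?I (?k N)) - M * (c * ?I (?k (Suc N)))"
      by (simp add: algebra_simps)
    also have "\<dots> = r / 2 + M / (2 * real N + 2)"
      unfolding one two by (simp add: field_simps)
    finally show ?thesis using eq \<open>c > 0\<close> by (simp add: abs_mult)
  qed
  have "(\<lambda>N. r / 2 + M / (2 * real N + 2)) \<longlonglongrightarrow> r / 2 + 0"
    by real_asymp
  hence "\<forall>\<^sub>F N in sequentially. r / 2 + M / (2 * real N + 2) < r"
    using \<open>r > 0\<close> order_tendstoD(2)[of _ "r / 2 + 0" sequentially r] by simp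
  then obtain n where "\<And>N. N \<ge> n \<Longrightarrow> r / 2 + M / (2 * real N + 2) < r"
    by (auto simp: eventually_sequentially)
  thus "\<exists>no. \<forall>n\<ge>no. norm (vallee_poussin_mean lam g n x - g x) < r"
    using bound unfolding real_norm_def by (blast intro: le_less_trans)
qed

text \<open>By evenness the indices \<open>j < N\<close> and \<open>j \<ge> N\<close> each give a
  partial sum of the one-sided series, so the bound does not depend on \<open>N\<close>.\<close>

lemma sum_abs_int_diff_le:
  fixes h :: "int \<Rightarrow> real"
  assumes "summable (\<lambda>n. h (int n))" "\<And>n. h n \<ge> 0" "\<And>n. h (- n) = h n" "h 0 = 0"
  shows "(\<Sum>j\<le>2*N. h (int j - int N)) \<le> 2 * (\<Sum>n. h (int n))"
proof -
  have "{..2*N} = {..<N} \<union> {N..2*N}" by auto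
  hence "(\<Sum>j\<le>2*N. h (int j - int N)) = (\<Sum>j<N. h (int j - int N)) + (\<Sum>j=N..2*N. h (int j - int N))"
    by (simp add: sum.union_disjoint ivl_disj_int)
  also have "(\<Sum>j<N. h (int j - int N)) = (\<Sum>n\<in>{1..N}. h (int n))"
  proof (rule sum.reindex_bij_witness[of _ "\<lambda>n. N - n" "\<lambda>j. N - j"])
    fix j assume "j \<in> {..<N}"
    thus "h (int (N - j)) = h (int j - int N)"
      using assms(3)[of "int (N - j)"] by (simp add: of_nat_diff)
  qed auto
  also have "(\<Sum>j=N..2*N. h (int j - int N)) = (\<Sum>n\<in>{0..N}. h (int n))"
    by (rule sum.reindex_bij_witness[of _ "\<lambda>n. N + n" "\<lambda>j. j - N"]) (auto simp: of_nat_diff)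
  also have "(\<Sum>n\<in>{1..N}. h (int n)) \<le> (\<Sum>n. h (int n))"
    using assms by (intro sum_le_suminf) auto
  also have "(\<Sum>n\<in>{0..N}. h (int n)) \<le> (\<Sum>n. h (int n))"
    using assms by (intro sum_le_suminf) auto
  finally show ?thesis by simp
qed

text \<open>Each term in the difference of two values of the mean is controlled by the interpolated
  sine bound, so the estimate holds for the means uniformly in \<open>N\<close>; it passes to
  \<open>g\<close> by pointwise convergence.\<close>

lemma hoelder_of_fourier_decay:
  assumes "lam > 0" and cont: "continuous_on UNIV g" and per: "periodic_with (period lam) g"
    and \<alpha>: "0 < \<alpha>" "\<alpha> < 1"
    and decay: "\<And>n. n \<noteq> 0 \<Longrightarrow> (of_int n)\<^sup>2 * norm (fourier_coeff lam g n) \<le> R"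
  shows "\<bar>g y - g x\<bar> \<le> 4 * R * (\<Sum>n. real n powr (\<alpha> - 2)) * \<bar>sin (lam * (y - x) / 2)\<bar> powr \<alpha>"
proof -
  let ?S = "\<Sum>n. real n powr (\<alpha> - 2)"
  let ?s = "\<bar>sin (lam * (y - x) / 2)\<bar> powr \<alpha>"
  let ?e = "\<lambda>n x. exp (\<i> * complex_of_real (lam * of_int n * x))"
  have "R \<ge> 0" using decay[of 1] norm_ge_zero[of "fourier_coeff lam g 1"] by (simp del: norm_ge_zero)
  \<comment> \<open>For \<open>n = 0\<close> both sides are 0: the exponentials cancel, and
    \<open>0 powr (\<alpha> - 2)\<close> is 0 by convention. The same convention removes the term
    \<open>n = 0\<close> from the series.\<close>
  have coeff: "norm (fourier_coeff lam g n * (?e n y - ?e n x)) \<le> 2 * R * ?s * \<bar>of_int n\<bar> powr (\<alpha> - 2)" for n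
  proof (cases "n = 0")
    case False
    have n: "real_of_int n \<noteq> 0" using False by simp
    have c: "norm (fourier_coeff lam g n) \<le> R / (of_int n)\<^sup>2"
      using decay[OF False] n by (simp add: field_simps)
    have "norm (?e n y - ?e n x) = 2 * \<bar>sin (of_int n * (lam * (y - x) / 2))\<bar>"
      unfolding norm_exp_i_diff by (simp add: algebra_simps diff_divide_distrib)
    also have "\<dots> \<le> 2 * (\<bar>of_int n\<bar> powr \<alpha> * ?s)"
      using \<alpha> by (intro mult_left_mono sin_int_mult_le_powr) auto
    finally have "norm (fourier_coeff lam g n * (?e n y - ?e n x)) \<le> R / (of_int n)\<^sup>2 * (2 * (\<bar>of_int n\<bar> powr \<alpha> * ?s))"
      unfolding norm_mult using c \<open>R \<ge> 0\<close> by (intro mult_mono) auto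
    also have "\<dots> = 2 * R * ?s * (\<bar>of_int n\<bar> powr \<alpha> / (of_int n)\<^sup>2)"
      by simp
    also have "\<bar>of_int n\<bar> powr \<alpha> / (of_int n :: real)\<^sup>2 = \<bar>of_int n\<bar> powr (\<alpha> - 2)"
      using n by (simp add: powr_diff powr_numeral)
    finally show ?thesis .
  qed simp
  have bound: "\<bar>vallee_poussin_mean lam g N y - vallee_poussin_mean lam g N x\<bar> \<le> 4 * R * ?S * ?s" for N
  proof -
    let ?B = "\<lambda>j. complex_of_nat (2*N choose j)"
    have mk: "complex_of_real (real (2*N choose N)) * complex_of_real (vallee_poussin_mean lam g N x) =
      (\<Sum>j\<le>2*N. ?B j * (fourier_coeff lam g (int j - int N) * ?e (int j - int N) x))" for x
    proof -
      have "real (2*N choose N) * vallee_poussin_mean lam g N x =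
        4 ^ N * (lam / (2 * pi) * integral {0..period lam} (\<lambda>\<theta>. g \<theta> * cos (lam * (x - \<theta>) / 2) ^ (2 * N)))"
        unfolding vallee_poussin_mean_def by simp
      thus ?thesis using cos_power_convolution[OF cont, of N lam x] by (metis of_real_mult)
    qed
    have "complex_of_real (real (2*N choose N) * (vallee_poussin_mean lam g N y - vallee_poussin_mean lam g N x)) =
      (\<Sum>j\<le>2*N. ?B j * (fourier_coeff lam g (int j - int N) * (?e (int j - int N) y - ?e (int j - int N) x)))"
      using mk[of x] mk[of y] by (simp only: of_real_mult of_real_diff right_diff_distrib sum_subtractf)
    hence "\<bar>real (2*N choose N) * (vallee_poussin_mean lam g N y - vallee_poussin_mean lam g N x)\<bar> =
      norm (\<Sum>j\<le>2*N. ?B j * (fourier_coeff lam g (int j - int N) * (?e (int j - int N) y - ?e (int j - int N) x)))"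
      by (metis norm_of_real)
    \<comment> \<open>The central binomial coefficient is the largest, so every Fourier multiplier
      of the normalized kernel is at most 1.\<close>
    also have "\<dots> \<le> (\<Sum>j\<le>2*N. real (2*N choose N) * (2 * R * ?s * \<bar>of_int (int j - int N)\<bar> powr (\<alpha> - 2)))"
    proof (rule sum_norm_le)
      fix j
      show "norm (?B j * (fourier_coeff lam g (int j - int N) * (?e (int j - int N) y - ?e (int j - int N) x)))
        \<le> real (2*N choose N) * (2 * R * ?s * \<bar>of_int (int j - int N)\<bar> powr (\<alpha> - 2))"
        unfolding norm_mult[of "?B j"] using coeff[of "int j - int N"]
        by (intro mult_mono) (auto simp: binomial_maximum')
    qed
    also have "\<dots> = real (2*N choose N) * (2 * R * ?s * (\<Sum>j\<le>2*N. \<bar>of_int (int j - int N)\<bar> powr (\<alpha> - 2)))"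
      by (simp only: sum_distrib_left)
    also have "\<dots> \<le> real (2*N choose N) * (2 * R * ?s * (2 * ?S))"
    proof (intro mult_left_mono)
      have "(\<Sum>j\<le>2*N. \<bar>of_int (int j - int N)\<bar> powr (\<alpha> - 2)) \<le> 2 * (\<Sum>n. \<bar>of_int (int n)\<bar> powr (\<alpha> - 2))"
        using \<alpha> by (intro sum_abs_int_diff_le) (auto simp: summable_real_powr_iff)
      thus "(\<Sum>j\<le>2*N. \<bar>of_int (int j - int N)\<bar> powr (\<alpha> - 2)) \<le> 2 * ?S" by simp
    qed (use \<open>R \<ge> 0\<close> in auto)
    finally have "real (2*N choose N) * \<bar>vallee_poussin_mean lam g N y - vallee_poussin_mean lam g N x\<bar>
       \<le> real (2*N choose N) * (4 * R * ?S * ?s)"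
      by (simp add: abs_mult mult_ac)
    thus ?thesis by simp
  qed
  have "(\<lambda>N. \<bar>vallee_poussin_mean lam g N y - vallee_poussin_mean lam g N x\<bar>) \<longlonglongrightarrow> \<bar>g y - g x\<bar>"
    by (intro tendsto_intros vallee_poussin_mean_tendsto assms)
  thus ?thesis using bound by (intro LIMSEQ_le_const2) auto
qed

lemma mean_value_close:
  assumes "lam > 0" and cont: "continuous_on UNIV g" and osc: "\<And>x y. \<bar>g y - g x\<bar> \<le> D"
  shows "\<bar>g x - mean_value lam g\<bar> \<le> D"
proof -
  let ?L = "period lam"
  have int: "g integrable_on {0..?L}"
    by (intro integrable_continuous_real continuous_on_subset[OF cont]) auto
  have L: "?L > 0" "lam / (2 * pi) = 1 / ?L" using \<open>lam > 0\<close> by (auto simp: period_def)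
  have "norm (integral {0..?L} (\<lambda>\<theta>. g \<theta> - g x)) \<le> integral {0..?L} (\<lambda>_. D)"
    using osc by (intro integral_norm_bound_integral integrable_diff int) auto
  hence "\<bar>integral {0..?L} g - ?L * g x\<bar> \<le> ?L * D"
    using L integral_diff[OF int integrable_const_ivl, of "g x"] by (simp add: mult.commute)
  hence "\<bar>?L * (g x - mean_value lam g)\<bar> \<le> ?L * D"
    using L by (simp add: mean_value_def right_diff_distrib abs_minus_commute)
  thus ?thesis using L by (simp add: abs_mult)
qed

section \<open>The two-point maximum principle\<close>

text \<open>The set where \<open>Z\<close> is nonnegative is compact, so its earliest time is
  attained. A positive value at that time would, by the intermediate value theorem, be preceded by
  an earlier zero. Hence at \<open>t1\<close> the point \<open>x\<close> maximizes \<open>Z\<close>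
  in space, and \<open>t1\<close> is a maximum from the left in time.\<close>

lemma first_touching:
  fixes Z :: "'a::metric_space \<Rightarrow> real \<Rightarrow> real"
  assumes "compact C" and cont: "continuous_on (C \<times> {t0..S}) (\<lambda>(x, t). Z x t)"
    and init: "\<And>x. x \<in> C \<Longrightarrow> Z x t0 < 0"
    and ex: "x0 \<in> C" "t0 \<le> t" "t \<le> S" "Z x0 t \<ge> 0"
  obtains x t1 where "x \<in> C" "t0 < t1" "t1 \<le> S" "Z x t1 = 0"
    "\<And>y. y \<in> C \<Longrightarrow> Z y t1 \<le> 0" "\<And>y s. y \<in> C \<Longrightarrow> t0 \<le> s \<Longrightarrow> s < t1 \<Longrightarrow> Z y s < 0"
proof -
  let ?K = "C \<times> {t0..S}"
  define D where "D = {z \<in> ?K. 0 \<le> (case z of (x, t) \<Rightarrow> Z x t)}"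
  have K: "compact ?K" using assms by (intro compact_Times) auto
  have "closed D" unfolding D_def
    using K cont by (intro continuous_on_closed_Collect_le) (auto intro: compact_imp_closed)
  hence "compact (?K \<inter> D)" using K by (intro compact_Int_closed)
  moreover have "?K \<inter> D = D" by (auto simp: D_def)
  ultimately have "compact D" by simp
  moreover have "(x0, t) \<in> D" using ex by (auto simp: D_def)
  moreover have "continuous_on D snd" by (intro continuous_intros)
  ultimately obtain z where z: "z \<in> D" "\<And>z'. z' \<in> D \<Longrightarrow> snd z \<le> snd z'"
    using continuous_attains_inf[of D snd] by blast
  obtain x t1 where zx: "z = (x, t1)" by (cases z)
  have x: "x \<in> C" "t0 \<le> t1" "t1 \<le> S" "Z x t1 \<ge> 0" using z(1) by (auto simp: zx D_def)
  have before: "Z y s < 0" if "y \<in> C" "t0 \<le> s" "s < t1" for y s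
    using z(2)[of "(y, s)"] that x by (force simp: D_def zx)
  have "t1 \<noteq> t0" using init[OF x(1)] x(4) by auto
  hence "t0 < t1" using x by simp
  have le: "Z y t1 \<le> 0" if y: "y \<in> C" for y
  proof (rule ccontr)
    assume "\<not> Z y t1 \<le> 0"
    moreover have "continuous_on {t0..t1} (\<lambda>s. Z y s)"
    proof -
      have "continuous_on {t0..t1} ((\<lambda>(x, t). Z x t) \<circ> (\<lambda>s. (y, s)))"
        by (intro continuous_on_compose continuous_intros continuous_on_subset[OF cont]) (use y x in auto)
      thus ?thesis by (simp add: o_def)
    qed
    ultimately obtain s where s: "t0 \<le> s" "s \<le> t1" "Z y s = 0"
      using IVT'[of "Z y" t0 0 t1] init[OF y] x by auto
    hence "s \<noteq> t1" using \<open>\<not> Z y t1 \<le> 0\<close> by auto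
    thus False using before[OF y, of s] s by auto
  qed
  show ?thesis
    using x(4) le[OF x(1)] by (intro that[OF x(1) \<open>t0 < t1\<close> x(3) _ le before]) auto
qed

section \<open>First and second derivative tests at a touching point\<close>

lemma DERIV_left_max_nonneg:
  fixes f :: "real \<Rightarrow> real"
  assumes "(f has_real_derivative d) (at t1)" "t0 < t1" "\<And>s. t0 \<le> s \<Longrightarrow> s < t1 \<Longrightarrow> f s \<le> f t1"
  shows "d \<ge> 0"
proof (rule ccontr)
  assume "\<not> d \<ge> 0"
  then obtain e where e: "e > 0" "\<And>h. 0 < h \<Longrightarrow> h < e \<Longrightarrow> f t1 < f (t1 - h)"
    using DERIV_neg_dec_left[OF assms(1)] by auto
  define h where "h = min (e / 2) (t1 - t0)"
  have h: "0 < h" "h < e" "h \<le> t1 - t0" using e(1) assms(2) by (auto simp: h_def)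
  have "f t1 < f (t1 - h)" using h by (intro e(2))
  moreover have "f (t1 - h) \<le> f t1" using h by (intro assms(3)) auto
  ultimately show False by simp
qed

text \<open>A positive second derivative would make \<open>G1\<close> positive just to the right of
  its zero at 0, and \<open>G\<close> would strictly increase there.\<close>

lemma DERIV2_local_max_nonpos:
  fixes G :: "real \<Rightarrow> real"
  assumes "e > 0" and G1: "\<And>h. \<bar>h\<bar> < e \<Longrightarrow> (G has_real_derivative G1 h) (at h)"
    and G2: "(G1 has_real_derivative d) (at 0)"
    and max: "\<And>h. \<bar>h\<bar> < e \<Longrightarrow> G h \<le> G 0"
  shows "d \<le> 0"
proof (rule ccontr)
  assume "\<not> d \<le> 0"
  have "G1 0 = 0"
  proof (rule DERIV_local_max[OF G1 \<open>e > 0\<close>])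
    show "\<forall>y. \<bar>0 - y\<bar> < e \<longrightarrow> G y \<le> G 0" using max by simp
  qed (use \<open>e > 0\<close> in simp)
  then obtain c where c: "c > 0" "\<And>h. 0 < h \<Longrightarrow> h < c \<Longrightarrow> G1 h > 0"
    using DERIV_pos_inc_right[OF G2] \<open>\<not> d \<le> 0\<close> by auto
  define h where "h = min c e / 2"
  have h: "0 < h" "h < c" "h < e" using c(1) \<open>e > 0\<close> by (auto simp: h_def min_def)
  have "G 0 < G h"
  proof (rule DERIV_pos_imp_increasing_open[OF h(1)])
    fix x assume "0 < x" "x < h"
    hence "\<bar>x\<bar> < e" "G1 x > 0" using h c(2)[of x] by simp_all
    thus "\<exists>y. (G has_real_derivative y) (at x) \<and> y > 0" using G1 by blast
  next
    show "continuous_on {0..h} G"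
    proof (rule DERIV_continuous_on)
      fix x assume "x \<in> {0..h}"
      thus "(G has_real_derivative G1 x) (at x within {0..h})"
        using h by (intro has_field_derivative_at_within[OF G1]) auto
    qed
  qed
  thus False using max[of h] h by simp
qed

text \<open>The derivative of the power increases, so its value at the larger point bounds the
  difference quotient. This serves the reaction term \<open>v powr q * v\<close>.\<close>

lemma powr_diff_le:
  fixes x y q :: real
  assumes "0 < x" "x \<le> y" "0 \<le> q"
  shows "y powr (1 + q) - x powr (1 + q) \<le> (1 + q) * y powr q * (y - x)"
proof (cases "x = y")
  case False
  hence "x < y" using assms by simp
  have "\<exists>z. x < z \<and> z < y \<and> y powr (1 + q) - x powr (1 + q) = (y - x) * ((1 + q) * z powr q)"
    using \<open>x < y\<close> assms has_real_derivative_powr[of _ "1 + q"] by (intro MVT2) auto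
  then obtain z where z: "x < z" "z < y" "y powr (1 + q) - x powr (1 + q) = (y - x) * ((1 + q) * z powr q)"
    by blast
  have "z powr q \<le> y powr q" using z assms by (intro powr_mono2) auto
  hence "(y - x) * ((1 + q) * z powr q) \<le> (y - x) * ((1 + q) * y powr q)"
    using assms by (intro mult_left_mono) auto
  thus ?thesis using z by (simp add: mult_ac)
qed simp

section \<open>Powers of the sine as comparison functions\<close>

context
  fixes lam \<alpha> s :: real
  assumes lam: "lam > 0" and s: "0 < s" "s < pi / lam"
begin

lemma sin_pos_half_period: "sin (lam * s) > 0"
  using lam s by (intro sin_gt_zero) (auto simp: field_simps)

lemma DERIV_sin_powr:
  "((\<lambda>s. sin (lam * s) powr r) has_real_derivative r * sin (lam * s) powr (r - 1) * (lam * cos (lam * s))) (at s)"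
proof -
  have "((\<lambda>s. sin (lam * s)) has_real_derivative lam * cos (lam * s)) (at s)"
    by (auto intro!: derivative_eq_intros)
  from DERIV_chain2[OF has_real_derivative_powr[OF sin_pos_half_period] this] show ?thesis .
qed

lemma DERIV2_sin_powr:
  "((\<lambda>s. \<alpha> * sin (lam * s) powr (\<alpha> - 1) * (lam * cos (lam * s))) has_real_derivative
     - \<alpha> * lam\<^sup>2 * (sin (lam * s) powr \<alpha> + (1 - \<alpha>) * sin (lam * s) powr (\<alpha> - 2) * (cos (lam * s))\<^sup>2)) (at s)"
proof -
  define S where "S = sin (lam * s)"
  have *: "S powr \<alpha> = S powr (\<alpha> - 1) * S"
    using sin_pos_half_period by (simp add: powr_diff S_def)
  have c: "((\<lambda>s. lam * cos (lam * s)) has_real_derivative - lam\<^sup>2 * sin (lam * s)) (at s)"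
    by (auto intro!: derivative_eq_intros simp: power2_eq_square)
  show ?thesis
    by (rule DERIV_cong[OF DERIV_mult[OF DERIV_cmult[OF DERIV_sin_powr] c]]) (simp add: * algebra_simps power2_eq_square flip: S_def)
qed

end

text \<open>The bounds on \<open>q\<close> correspond to p \<ge> 1 in
  \<open>q = (p + 1) / p\<close>. Continuity reaches down to time 0 while derivatives are given only
  at positive times, so estimates through \<open>v1\<close> have to start later than 0.\<close>

locale curvature_flow =
  fixes lam T q :: real and v v1 v2 :: "real \<Rightarrow> real \<Rightarrow> real"
  assumes lam_pos: "lam > 0" and T_pos: "T > 0" and q1: "1 \<le> q" and q2: "q \<le> 2"
    and per: "\<And>t. 0 \<le> t \<Longrightarrow> t < T \<Longrightarrow> periodic_with (period lam) (\<lambda>x. v x t)"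
    and pos: "\<And>x t. 0 \<le> t \<Longrightarrow> t < T \<Longrightarrow> 0 < v x t"
    and cont: "continuous_on (UNIV \<times> {0..<T}) (\<lambda>(x, t). v x t)"
    and dx: "\<And>x t. 0 < t \<Longrightarrow> t < T \<Longrightarrow> ((\<lambda>x. v x t) has_real_derivative v1 x t) (at x)"
    and dxx: "\<And>x t. 0 < t \<Longrightarrow> t < T \<Longrightarrow> ((\<lambda>x. v1 x t) has_real_derivative v2 x t) (at x)"
    and dt: "\<And>x t. 0 < t \<Longrightarrow> t < T \<Longrightarrow>
       ((\<lambda>s. v x s) has_real_derivative v x t powr q * (v2 x t + v x t)) (at t)"
begin

section \<open>Periodicity and compactness\<close>

lemma period_pos: "period lam > 0"
  using lam_pos by (simp add: period_def)

lemma shift_into_period: "\<exists>n::int. x + of_int n * period lam \<in> {0..period lam}"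
proof -
  let ?n = "\<lfloor>x / period lam\<rfloor>"
  have "of_int ?n \<le> x / period lam" "x / period lam < of_int ?n + 1" by linarith+
  hence "of_int ?n * period lam \<le> x" "x < (of_int ?n + 1) * period lam"
    using period_pos by (simp_all only: pos_le_divide_eq pos_divide_less_eq)
  thus ?thesis by (intro exI[of _ "- ?n"]) (auto simp: algebra_simps)
qed

lemma v_shift:
  assumes "0 \<le> t" "t < T"
  shows "v (x + of_int n * period lam) t = v x t"
  using periodic_with_shift[OF per[OF assms], of x n] .

text \<open>One translation serves all offsets \<open>h\<close>, so the two points of a pair are
  moved together and keep their distance.\<close>

lemma ex_representative:
  assumes "0 \<le> t" "t < T"
  obtains x' where "x' \<in> {0..period lam}" "\<And>h. v (x' + h) t = v (x + h) t"
proof -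
  obtain n :: int where "x + of_int n * period lam \<in> {0..period lam}" using shift_into_period by blast
  moreover have "v (x + of_int n * period lam + h) t = v (x + h) t" for h
    using v_shift[OF assms, of "x + h" n] by (simp add: algebra_simps)
  ultimately show ?thesis by (rule that)
qed

lemma cont_compose:
  assumes "continuous_on S f" "continuous_on S g" "\<And>z. z \<in> S \<Longrightarrow> 0 \<le> g z \<and> g z < T"
  shows "continuous_on S (\<lambda>z. v (f z) (g z))"
proof -
  have "continuous_on S ((\<lambda>(x, t). v x t) \<circ> (\<lambda>z. (f z, g z)))"
    using assms by (intro continuous_on_compose continuous_on_Pair continuous_on_subset[OF cont]) auto
  thus ?thesis by (simp add: o_def)
qed

lemma bounded_before:
  assumes "0 \<le> S" "S < T"
  shows "\<exists>M>0. \<forall>x t. 0 \<le> t \<longrightarrow> t \<le> S \<longrightarrow> v x t \<le> M"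
proof -
  let ?K = "{0..period lam} \<times> {0..S}"
  have "continuous_on ?K (\<lambda>z. v (fst z) (snd z))"
    using assms by (intro cont_compose continuous_intros) auto
  moreover have "compact ?K" by (intro compact_Times) auto
  moreover have "?K \<noteq> {}" using assms period_pos by auto
  ultimately obtain z where z: "z \<in> ?K" "\<And>w. w \<in> ?K \<Longrightarrow> v (fst w) (snd w) \<le> v (fst z) (snd z)"
    using continuous_attains_sup[of ?K "\<lambda>z. v (fst z) (snd z)"] by blast
  have "v x t \<le> v (fst z) (snd z)" if "0 \<le> t" "t \<le> S" for x t
  proof -
    have t: "0 \<le> t" "t < T" using that assms by auto
    obtain x' where x': "x' \<in> {0..period lam}" "\<And>h. v (x' + h) t = v (x + h) t"
      using ex_representative[OF t, of x] by blast
    have "v x' t = v x t" using x'(2)[of 0] by simp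
    thus ?thesis using z(2)[of "(x', t)"] that x'(1) by simp
  qed
  moreover have "v (fst z) (snd z) > 0" using z(1) assms by (intro pos) auto
  ultimately show ?thesis by blast
qed

text \<open>Modulo the period every pair of points is \<open>x\<close>, \<open>x + 2 * s\<close>
  with \<open>s\<close> between 0 and \<open>pi / lam\<close>, since \<open>2 * s\<close> then runs
  through a whole period.\<close>

lemma oscillation_bound:
  assumes "0 \<le> t" "t < T" and "\<And>x s. 0 \<le> s \<Longrightarrow> s \<le> pi / lam \<Longrightarrow> v (x + 2 * s) t - v x t \<le> D"
  shows "v y t - v x t \<le> D"
proof -
  obtain n :: int where n: "(y - x) + of_int n * period lam \<in> {0..period lam}" using shift_into_period by blast
  have "v (x + 2 * ((y - x + of_int n * period lam) / 2)) t - v x t \<le> D"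
    using n by (intro assms(3)) (auto simp: period_def mult.commute)
  moreover have "x + 2 * ((y - x + of_int n * period lam) / 2) = y + of_int n * period lam"
    by (simp add: field_simps)
  ultimately show ?thesis using v_shift[OF assms(1,2), of y n] by simp
qed

text \<open>The comparison function is perturbed by a small exponentially growing constant, so that a first
  touching point lies off the diagonal. There the second derivative of the difference is tested in the
  direction in which \<open>x\<close> and \<open>y\<close> move apart with speeds \<open>v(x)\<^bsup>q/2\<^esup>\<close> and \<open>v(y)\<^bsup>q/2\<^esup>\<close>; this
  produces exactly the two diffusion terms and no others.\<close>

lemma modulus_comparison:
  assumes t0: "0 \<le> t0" "t0 < T" and \<alpha>: "0 < \<alpha>" "\<alpha> \<le> 1"
    and A_pos: "\<And>t. t0 \<le> t \<Longrightarrow> t < T \<Longrightarrow> A t > 0"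
    and A_cont: "continuous_on {t0..<T} A"
    and A_deriv: "\<And>t. t0 < t \<Longrightarrow> t < T \<Longrightarrow> (A has_real_derivative A' t) (at t)"
    and init: "\<And>x s. 0 \<le> s \<Longrightarrow> s \<le> pi / lam \<Longrightarrow> v (x + 2 * s) t0 - v x t0 \<le> 2 * A t0 * sin (lam * s) powr \<alpha>"
    and super: "\<And>t x y. t0 < t \<Longrightarrow> t < T \<Longrightarrow> (\<And>x y. v y t - v x t \<le> 3 * A t) \<Longrightarrow>
       A t * ((1 + q) * v y t powr q - \<alpha> * lam\<^sup>2 * v x t powr q) \<le> A' t"
    and ts: "t0 \<le> t" "t < T" "0 \<le> s" "s \<le> pi / lam"
  shows "v (x + 2 * s) t - v x t \<le> 2 * A t * sin (lam * s) powr \<alpha>"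
proof (rule ccontr)
  let ?f = "\<lambda>s. sin (lam * s) powr \<alpha>"
  assume neg: "\<not> ?thesis"
  define gap where "gap = v (x + 2 * s) t - v x t - 2 * A t * ?f s"
  have gap: "gap > 0" using neg by (simp add: gap_def)
  obtain M where M: "M > 0" "\<And>x r. 0 \<le> r \<Longrightarrow> r \<le> t \<Longrightarrow> v x r \<le> M"
    using bounded_before[of t] t0 ts by auto
  \<comment> \<open>\<open>N\<close> strictly exceeds the rate at which the reaction can amplify the
    perturbation.\<close>
  define N where "N = (1 + q) * M powr q + 1"
  define E where "E = (\<lambda>r. exp (N * (r - t0)))"
  have "N > 0" using q1 by (auto simp: N_def intro: add_nonneg_pos)
  obtain a where a: "a > 0" "\<And>r. t0 \<le> r \<Longrightarrow> r \<le> t \<Longrightarrow> a \<le> A r"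
  proof -
    have "continuous_on {t0..t} A" using ts by (intro continuous_on_subset[OF A_cont]) auto
    then obtain r where "r \<in> {t0..t}" "\<And>r'. r' \<in> {t0..t} \<Longrightarrow> A r \<le> A r'"
      using continuous_attains_inf[of "{t0..t}" A] ts by auto
    thus ?thesis using A_pos[of r] ts by (intro that[of "A r"]) auto
  qed
  \<comment> \<open>Two requirements are met: at time \<open>t\<close> the perturbation is at most
    the violation \<open>gap\<close>, so that \<open>Z\<close> still reaches 0, and up to then it is
    at most \<open>A\<close>, so that the oscillation at the touching time is at most
    \<open>2 * A + A\<close>, the bound under which \<open>super\<close> applies.\<close>
  define \<epsilon> where "\<epsilon> = min gap a / E t"
  have E: "E r > 0" for r by (simp add: E_def)
  have \<epsilon>: "\<epsilon> > 0" "\<epsilon> * E t \<le> gap" "\<epsilon> * E t \<le> a" using gap a E[of t] by (auto simp: \<epsilon>_def)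
  have \<epsilon>E: "\<epsilon> * E r \<le> a" if "r \<le> t" for r
  proof -
    have "E r \<le> E t" using that \<open>N > 0\<close> by (simp add: E_def)
    thus ?thesis using \<epsilon> by (meson less_imp_le mult_left_mono order_trans)
  qed
  define Z where "Z = (\<lambda>(x, s) r. v (x + 2 * s) r - v x r - 2 * A r * ?f s - \<epsilon> * E r)"
  have Z: "Z (x, s) r = v (x + 2 * s) r - v x r - 2 * A r * ?f s - \<epsilon> * E r" for x s r
    by (simp add: Z_def)
  let ?C = "{0..period lam} \<times> {0..pi / lam}"
  have f_nonneg: "sin (lam * s) \<ge> 0" if "0 \<le> s" "s \<le> pi / lam" for s
    using that lam_pos by (intro sin_ge_zero) (auto simp: field_simps)
  have Z_shift: "\<exists>x'\<in>{0..period lam}. \<forall>s. Z (x', s) r = Z (x, s) r" if r: "0 \<le> r" "r < T" for x r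
  proof -
    obtain x' where x': "x' \<in> {0..period lam}" "\<And>h. v (x' + h) r = v (x + h) r"
      using ex_representative[OF r, of x] by blast
    have "v x' r = v x r" using x'(2)[of 0] by simp
    thus ?thesis using x' by (intro bexI[of _ x']) (auto simp: Z)
  qed
  have 1: "compact ?C" by (intro compact_Times) auto
  have 2: "continuous_on (?C \<times> {t0..t}) (\<lambda>(z, r). Z z r)"
  proof -
    let ?K = "?C \<times> {t0..t}"
    have "continuous_on ?K (\<lambda>w. v (fst (fst w) + 2 * snd (fst w)) (snd w))"
      using ts t0 by (intro cont_compose continuous_intros) auto
    moreover have "continuous_on ?K (\<lambda>w. v (fst (fst w)) (snd w))"
      using ts t0 by (intro cont_compose continuous_intros) auto
    moreover have "continuous_on ?K (\<lambda>w. A (snd w))"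
      using ts by (intro continuous_on_compose2[OF A_cont] continuous_intros) auto
    moreover have "continuous_on ?K (\<lambda>w. ?f (snd (fst w)))"
    proof (rule continuous_on_powr')
      show "\<forall>w\<in>?K. 0 \<le> sin (lam * snd (fst w)) \<and> (sin (lam * snd (fst w)) = 0 \<longrightarrow> 0 < \<alpha>)"
        using f_nonneg \<alpha> by auto
    qed (intro continuous_intros)+
    moreover have "continuous_on ?K (\<lambda>w. E (snd w))"
      unfolding E_def by (intro continuous_intros)
    ultimately have "continuous_on ?K (\<lambda>w. v (fst (fst w) + 2 * snd (fst w)) (snd w) - v (fst (fst w)) (snd w)
        - 2 * A (snd w) * ?f (snd (fst w)) - \<epsilon> * E (snd w))"
      by (intro continuous_on_diff continuous_on_mult continuous_on_const)
    thus ?thesis unfolding Z_def case_prod_unfold .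
  qed
  have 3: "Z z t0 < 0" if "z \<in> ?C" for z
  proof -
    have "\<epsilon> * E t0 > 0" using \<epsilon>(1) E[of t0] by simp
    moreover obtain x s where "z = (x, s)" "0 \<le> s" "s \<le> pi / lam" using \<open>z \<in> ?C\<close> by auto
    ultimately show ?thesis using init[of s x] by (simp add: Z)
  qed
  obtain x0 where x0: "x0 \<in> {0..period lam}" "Z (x0, s) t = Z (x, s) t" 
    using Z_shift[of t x] t0 ts by (meson order_trans)
  have 4: "(x0, s) \<in> ?C" "Z (x0, s) t \<ge> 0" using x0 ts \<epsilon>(2) by (auto simp: Z gap_def)
  obtain z t1 where zt: "z \<in> ?C" "t0 < t1" "t1 \<le> t" "Z z t1 = 0"
    "\<And>y. y \<in> ?C \<Longrightarrow> Z y t1 \<le> 0" "\<And>y r. y \<in> ?C \<Longrightarrow> t0 \<le> r \<Longrightarrow> r < t1 \<Longrightarrow> Z y r < 0"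
  proof -
    show thesis
    proof (rule first_touching[OF 1 2 _ 4(1) ts(1) order_refl 4(2)])
      show "Z z t0 < 0" if "z \<in> ?C" for z using that by (rule 3)
    qed (rule that)
  qed
  obtain x s where z: "z = (x, s)" by (cases z)
  have t1: "0 < t1" "t1 < T" "0 \<le> t1" using zt t0 ts by auto
  have s: "0 \<le> s" "s \<le> pi / lam" using zt(1) z by auto
  have Z_le: "Z (x, s) t1 \<le> 0" if s: "0 \<le> s" "s \<le> pi / lam" for x s
  proof -
    obtain x' where "x' \<in> {0..period lam}" "Z (x', s) t1 = Z (x, s) t1" 
      using Z_shift[of t1 x] t1 by meson
    thus ?thesis using zt(5)[of "(x', s)"] s by auto
  qed
  have touch: "v (x + 2 * s) t1 - v x t1 = 2 * A t1 * ?f s + \<epsilon> * E t1"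
    using zt(4) by (simp add: z Z)
  have "\<epsilon> * E t1 > 0" using \<epsilon> E by simp
  \<comment> \<open>At both ends of the range of \<open>s\<close> the two points coincide modulo the
    period while the perturbation is positive. So the touching point is interior, where the power of
    the sine is smooth.\<close>
  have "s \<noteq> 0" using touch \<open>\<epsilon> * E t1 > 0\<close> by auto
  moreover have "s \<noteq> pi / lam"
  proof
    assume "s = pi / lam"
    hence "v (x + 2 * s) t1 = v x t1" "sin (lam * s) = 0"
      using v_shift[OF t1(3,2), of x 1] lam_pos by (auto simp: period_def)
    thus False using touch \<open>\<epsilon> * E t1 > 0\<close> by auto
  qed
  ultimately have s': "0 < s" "s < pi / lam" using s by auto
  define y where "y = x + 2 * s"
  let ?vx = "v x t1" and ?vy = "v y t1"
  have vpos: "?vx > 0" "?vy > 0" using pos[OF t1(3,2)] by auto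
  have A1: "A t1 > 0" using A_pos[of t1] zt(2,3) ts by auto
  have fpos: "?f s > 0" using sin_pos_half_period[OF lam_pos s'] by simp
  have "2 * A t1 * ?f s > 0" using A1 fpos by (intro mult_pos_pos) auto
  hence vxy: "?vx \<le> ?vy" using touch[folded y_def] \<open>\<epsilon> * E t1 > 0\<close> by linarith
  have osc: "v y t1 - v x t1 \<le> 3 * A t1" for x y
  proof (rule oscillation_bound[OF t1(3,2)])
    fix x s assume s: "0 \<le> s" "s \<le> pi / lam"
    have "v (x + 2 * s) t1 - v x t1 \<le> 2 * A t1 * ?f s + \<epsilon> * E t1"
      using Z_le[OF s, of x] by (simp add: Z)
    also have "\<dots> \<le> 2 * A t1 * 1 + A t1"
      using A1 \<alpha> f_nonneg[OF s] \<epsilon>E[of t1] a(2)[of t1] zt(2,3)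
      by (intro add_mono mult_left_mono powr_le1) auto
    finally show "v (x + 2 * s) t1 - v x t1 \<le> 3 * A t1" by simp
  qed
  have time: "0 \<le> ?vy powr q * (v2 y t1 + ?vy) - ?vx powr q * (v2 x t1 + ?vx) - 2 * A' t1 * ?f s - \<epsilon> * (N * E t1)"
  proof (rule DERIV_left_max_nonneg[of "Z (x, s)"])
    show "(Z (x, s) has_real_derivative
      ?vy powr q * (v2 y t1 + ?vy) - ?vx powr q * (v2 x t1 + ?vx) - 2 * A' t1 * ?f s - \<epsilon> * (N * E t1)) (at t1)"
    proof -
      have dE: "(E has_real_derivative N * E t1) (at t1)"
        unfolding E_def by (auto intro!: derivative_eq_intros)
      have dA: "((\<lambda>r. 2 * A r * ?f s) has_real_derivative 2 * A' t1 * ?f s) (at t1)"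
        by (intro DERIV_cmult_right DERIV_cmult A_deriv zt(2) t1)
      have "((\<lambda>r. v y r - v x r - 2 * A r * ?f s - \<epsilon> * E r) has_real_derivative
        ?vy powr q * (v2 y t1 + ?vy) - ?vx powr q * (v2 x t1 + ?vx) - 2 * A' t1 * ?f s - \<epsilon> * (N * E t1)) (at t1)"
        by (intro DERIV_diff DERIV_cmult dt t1 dA dE)
      thus ?thesis by (simp add: Z_def y_def)
    qed
    show "t0 < t1" by (rule zt)
    fix r assume "t0 \<le> r" "r < t1"
    thus "Z (x, s) r \<le> Z (x, s) t1" using zt(6)[of "(x, s)" r] zt(1,4) by (simp add: z)
  qed
  define a b where "a = ?vx powr (q / 2)" and "b = ?vy powr (q / 2)"
  have ab: "a > 0" "a \<le> b" "a\<^sup>2 = ?vx powr q" "b\<^sup>2 = ?vy powr q"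
    using vpos vxy q1 by (auto simp: a_def b_def powr_powr powr_power intro!: powr_mono2)
  \<comment> \<open>Moving to \<open>x - a * h\<close> and \<open>y + b * h\<close> changes the
    separation \<open>2 * s\<close> to \<open>2 * (s + c * h)\<close>.\<close>
  define c where "c = (a + b) / 2"
  have c: "c > 0" using ab by (simp add: c_def)
  let ?f1 = "\<lambda>s. \<alpha> * sin (lam * s) powr (\<alpha> - 1) * (lam * cos (lam * s))"
  let ?f2 = "- \<alpha> * lam\<^sup>2 * (sin (lam * s) powr \<alpha> + (1 - \<alpha>) * sin (lam * s) powr (\<alpha> - 2) * (cos (lam * s))\<^sup>2)"
  \<comment> \<open>Keeps \<open>s + c * h\<close> inside the interval where the sine is
    positive.\<close>
  define e where "e = min s (pi / lam - s) / c"
  have e: "e > 0" using s' c by (simp add: e_def)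
  have inside: "0 < s + c * h" "s + c * h < pi / lam" if "\<bar>h\<bar> < e" for h
  proof -
    have "c * \<bar>h\<bar> < min s (pi / lam - s)" using that c by (simp add: e_def field_simps)
    hence "\<bar>c * h\<bar> < s \<and> \<bar>c * h\<bar> < pi / lam - s" using c by (simp add: abs_mult)
    thus "0 < s + c * h" "s + c * h < pi / lam" by linarith+
  qed
  have space: "b * (b * v2 y t1) - a * (a * v2 x t1) - 2 * A t1 * (c * (c * ?f2)) \<le> 0"
  proof (rule DERIV2_local_max_nonpos[OF e])
    let ?G = "\<lambda>h. v (y + b * h) t1 - v (x - a * h) t1 - 2 * A t1 * ?f (s + c * h)"
    let ?G1 = "\<lambda>h. b * v1 (y + b * h) t1 + a * v1 (x - a * h) t1 - 2 * A t1 * (c * ?f1 (s + c * h))"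
    have lin: "((\<lambda>h. u + w * h) has_real_derivative w) (at h)" for u w h :: real
      by (auto intro!: derivative_eq_intros)
    have lin': "((\<lambda>h. u - w * h) has_real_derivative - w) (at h)" for u w h :: real
      by (auto intro!: derivative_eq_intros)
    show "(?G has_real_derivative ?G1 h) (at h)" if h: "\<bar>h\<bar> < e" for h
    proof -
      note D1 = DERIV_chain2[OF dx[OF t1(1,2)] lin, of y b h]
      note D2 = DERIV_chain2[OF dx[OF t1(1,2)] lin', of x a h]
      note D3 = DERIV_cmult[OF DERIV_chain2[OF DERIV_sin_powr[OF lam_pos inside[OF h], of \<alpha>] lin], of "2 * A t1"]
      show ?thesis
        by (rule DERIV_cong[OF DERIV_diff[OF DERIV_diff[OF D1 D2] D3]]) (simp add: mult_ac)
    qed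
    show "(?G1 has_real_derivative b * (b * v2 y t1) - a * (a * v2 x t1) - 2 * A t1 * (c * (c * ?f2))) (at 0)"
    proof -
      note i = inside[of 0, unfolded abs_zero, OF e]
      note D1 = DERIV_cmult[OF DERIV_chain2[OF dxx[OF t1(1,2)] lin, of y b 0], of b]
      note D2 = DERIV_cmult[OF DERIV_chain2[OF dxx[OF t1(1,2)] lin', of x a 0], of a]
      note D3 = DERIV_cmult[OF DERIV_cmult[OF DERIV_chain2[OF DERIV2_sin_powr[OF lam_pos i, of \<alpha>] lin], of c], of "2 * A t1"]
      show ?thesis
        by (rule DERIV_cong[OF DERIV_diff[OF DERIV_add[OF D1 D2] D3]]) (simp add: mult_ac)
    qed
    show "?G h \<le> ?G 0" if h: "\<bar>h\<bar> < e" for h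
    proof -
      have "Z (x - a * h, s + c * h) t1 \<le> Z (x, s) t1"
        using Z_le[of "s + c * h" "x - a * h"] inside[OF h] zt(4) by (simp add: z)
      moreover have eq: "x - a * h + 2 * (s + c * h) = y + b * h"
        by (simp add: y_def c_def field_simps)
      ultimately have "v (y + b * h) t1 - v (x - a * h) t1 - 2 * A t1 * ?f (s + c * h) \<le> ?vy - ?vx - 2 * A t1 * ?f s"
        unfolding Z eq y_def by linarith
      thus ?thesis by simp
    qed
  qed
  have "0 \<le> \<alpha> * lam\<^sup>2 * ((1 - \<alpha>) * sin (lam * s) powr (\<alpha> - 2) * (cos (lam * s))\<^sup>2)"
    using \<alpha> by simp
  hence f2: "?f2 \<le> - \<alpha> * lam\<^sup>2 * ?f s"
    by (simp add: distrib_left)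
  have "2 * A t1 * (c * (c * ?f2)) \<le> 2 * A t1 * (c * (c * (- \<alpha> * lam\<^sup>2 * ?f s)))"
    by (rule mult_left_mono[OF mult_left_mono[OF mult_left_mono[OF f2]]]) (use A1 c in simp_all)
  also have "\<dots> = - (2 * A t1 * (\<alpha> * lam\<^sup>2 * ?f s)) * (c * c)" by simp
  also have "- (2 * A t1 * (\<alpha> * lam\<^sup>2 * ?f s)) * (c * c) \<le> - (2 * A t1 * (\<alpha> * lam\<^sup>2 * ?f s)) * ?vx powr q"
  proof (rule mult_left_mono_neg)
    have "a * a \<le> c * c" using ab by (intro mult_mono) (auto simp: c_def)
    thus "?vx powr q \<le> c * c" using ab by (simp add: power2_eq_square)
    show "- (2 * A t1 * (\<alpha> * lam\<^sup>2 * ?f s)) \<le> 0" using A1 \<alpha> fpos by simp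
  qed
  finally have "2 * A t1 * (c * (c * ?f2)) \<le> - (2 * A t1 * (\<alpha> * lam\<^sup>2 * ?f s)) * ?vx powr q" .
  moreover have "?vy powr q * v2 y t1 = b * (b * v2 y t1)" "?vx powr q * v2 x t1 = a * (a * v2 x t1)"
    by (simp_all only: ab(3,4)[symmetric] power2_eq_square mult.assoc)
  ultimately have diffusion: "?vy powr q * v2 y t1 - ?vx powr q * v2 x t1 \<le> - (2 * A t1 * (\<alpha> * lam\<^sup>2 * ?f s)) * ?vx powr q"
    using space by linarith
  have "?vy powr q * ?vy - ?vx powr q * ?vx = ?vy powr (1 + q) - ?vx powr (1 + q)"
    using vpos by (simp add: powr_add)
  also have "\<dots> \<le> (1 + q) * ?vy powr q * (?vy - ?vx)"
    using vpos vxy q1 by (intro powr_diff_le) auto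
  also have "?vy - ?vx = 2 * A t1 * ?f s + \<epsilon> * E t1" using touch by (simp add: y_def)
  finally have reaction: "?vy powr q * ?vy - ?vx powr q * ?vx \<le> (1 + q) * ?vy powr q * (2 * A t1 * ?f s + \<epsilon> * E t1)" .
  have "A t1 * ((1 + q) * ?vy powr q - \<alpha> * lam\<^sup>2 * ?vx powr q) \<le> A' t1"
    using zt(2) t1(2) osc by (rule super)
  hence A': "2 * ?f s * (A t1 * ((1 + q) * ?vy powr q - \<alpha> * lam\<^sup>2 * ?vx powr q)) \<le> 2 * ?f s * A' t1"
    using fpos by (intro mult_left_mono) auto
  have "?vy powr q \<le> M powr q" using M(2)[of t1 y] zt(3) t1 vpos q1 by (intro powr_mono2) auto
  hence "(1 + q) * ?vy powr q \<le> (1 + q) * M powr q" using q1 by (intro mult_left_mono) auto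
  hence "(1 + q) * ?vy powr q < N" by (simp add: N_def)
  \<comment> \<open>The perturbation lowers \<open>Z\<close> faster than the reaction acting on it
    can raise \<open>Z\<close>; this strict inequality produces the contradiction.\<close>
  hence "(1 + q) * ?vy powr q * (\<epsilon> * E t1) < N * (\<epsilon> * E t1)"
    using \<open>\<epsilon> * E t1 > 0\<close> by (rule mult_strict_right_mono)
  moreover have "- (2 * A t1 * (\<alpha> * lam\<^sup>2 * ?f s)) * ?vx powr q + (1 + q) * ?vy powr q * (2 * A t1 * ?f s + \<epsilon> * E t1)
      = 2 * ?f s * (A t1 * ((1 + q) * ?vy powr q - \<alpha> * lam\<^sup>2 * ?vx powr q)) + (1 + q) * ?vy powr q * (\<epsilon> * E t1)"
    by (simp only: ring_distribs mult_minus_left) (simp add: mult_ac)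
  moreover have "\<epsilon> * (N * E t1) = N * (\<epsilon> * E t1)" "2 * A' t1 * ?f s = 2 * ?f s * A' t1" by simp_all
  moreover have "0 \<le> ?vy powr q * v2 y t1 + ?vy powr q * ?vy - (?vx powr q * v2 x t1 + ?vx powr q * ?vx) - 2 * A' t1 * ?f s - \<epsilon> * (N * E t1)"
    using time by (simp only: distrib_left)
  ultimately show False using diffusion reaction A' by linarith
qed

end

section \<open>Comparison with the blow-up profile\<close>

text \<open>A concave function lies above its chord, here the one from 0 to \<open>pi / 2\<close>.
  This converts a linear bound into a bound by the sine.\<close>

lemma jordan_inequality:
  fixes z :: real
  assumes "0 \<le> z" "z \<le> pi / 2"
  shows "2 / pi * z \<le> sin z"
proof -
  have "concave_on {0..pi / 2} (sin :: real \<Rightarrow> real)"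
  proof (rule f''_le0_imp_concave)
    fix x :: real assume x: "x \<in> {0..pi / 2}"
    show "(sin has_real_derivative cos x) (at x)" "(cos has_real_derivative - sin x) (at x)"
      by (auto intro!: derivative_eq_intros)
    show "- sin x \<le> 0" using x by (simp add: sin_ge_zero)
  qed auto
  from concave_onD_Icc'[OF this, of z] assms show ?thesis by simp
qed

section \<open>Comparison with spatially constant solutions\<close>

context curvature_flow
begin

text \<open>For spatially constant \<open>v\<close> the derivative is the constant
  \<open>-q\<close>: in the variable \<open>v powr - q\<close> such solutions are straight lines, so
  lines in time serve as barriers.\<close>

lemma DERIV_inverse_power:
  assumes "0 < t" "t < T"
  shows "((\<lambda>s. v x s powr - q) has_real_derivative - q * ((v2 x t + v x t) / v x t)) (at t)"
proof -
  have vp: "v x t > 0" using assms by (intro pos) auto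
  have "v x t powr (- q - 1) * v x t powr q = 1 / v x t"
    using vp by (simp add: powr_minus_divide flip: powr_add)
  hence "- q * v x t powr (- q - 1) * (v x t powr q * (v2 x t + v x t)) = - q * ((v2 x t + v x t) / v x t)"
    by (simp add: mult.assoc[symmetric]) (simp add: mult.assoc)
  thus ?thesis
    using DERIV_chain2[OF has_real_derivative_powr[OF vp, of "- q"] dt[OF assms]] by simp
qed

lemma second_derivative_at_max:
  assumes "0 < t" "t < T" "\<And>y. v y t \<le> v x t"
  shows "v2 x t \<le> 0"
proof -
  have lin: "((\<lambda>h. x + h) has_real_derivative 1) (at h)" for h
    by (auto intro!: derivative_eq_intros)
  show ?thesis
  proof (rule DERIV2_local_max_nonpos)
    show "(0::real) < 1" by simp
    show "((\<lambda>h. v (x + h) t) has_real_derivative v1 (x + h) t) (at h)" for h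
      using DERIV_chain2[OF dx[OF assms(1,2)] lin, of h] by simp
    show "((\<lambda>h. v1 (x + h) t) has_real_derivative v2 x t) (at 0)"
      using DERIV_chain2[OF dxx[OF assms(1,2)] lin, of 0] by simp
    show "v (x + h) t \<le> v (x + 0) t" for h using assms(3) by simp
  qed
qed

lemma second_derivative_at_min:
  assumes "0 < t" "t < T" "\<And>y. v x t \<le> v y t"
  shows "0 \<le> v2 x t"
proof -
  have lin: "((\<lambda>h. x + h) has_real_derivative 1) (at h)" for h
    by (auto intro!: derivative_eq_intros)
  have "- v2 x t \<le> 0"
  proof (rule DERIV2_local_max_nonpos)
    show "(0::real) < 1" by simp
    show "((\<lambda>h. - v (x + h) t) has_real_derivative - v1 (x + h) t) (at h)" for h
      using DERIV_minus[OF DERIV_chain2[OF dx[OF assms(1,2)] lin, of h]] by simp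
    show "((\<lambda>h. - v1 (x + h) t) has_real_derivative - v2 x t) (at 0)"
      using DERIV_minus[OF DERIV_chain2[OF dxx[OF assms(1,2)] lin, of 0]] by simp
    show "- v (x + h) t \<le> - v (x + 0) t" for h using assms(3) by simp
  qed
  thus ?thesis by simp
qed

lemma continuous_on_inverse_power:
  assumes "continuous_on S f" "continuous_on S g" "\<And>z. z \<in> S \<Longrightarrow> 0 \<le> g z \<and> g z < T"
  shows "continuous_on S (\<lambda>z. v (f z) (g z) powr - q)"
proof (intro continuous_on_powr cont_compose assms continuous_on_const ballI)
  fix z assume "z \<in> S"
  thus "v (f z) (g z) \<noteq> 0" using pos[of "g z" "f z"] assms(3)[of z] by auto
qed

lemma inverse_power_le_iff:
  assumes "0 \<le> t" "t < T"
  shows "v x t powr - q \<le> v y t powr - q \<longleftrightarrow> v y t \<le> v x t"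
proof -
  have "v x t > 0" "v y t > 0" using pos[OF assms] by auto
  thus ?thesis using powr_less_mono2_neg[of "- q" "v x t" "v y t"] powr_mono2'[of "- q" "v y t" "v x t"] q1
    by (cases "v y t \<le> v x t") auto
qed

text \<open>If \<open>v\<close> lay above the profile everywhere, \<open>v powr - q\<close> would
  stay below a line that reaches 0 at some \<open>S < T\<close>, although it is positive. The line
  has slope \<open>- q * r\<close> with \<open>r < 1\<close>, while at a first touching point, a
  spatial minimum of \<open>v\<close>, the equation forces a slope of at most
  \<open>-q\<close>.\<close>

lemma ex_le_blowup_profile:
  assumes t: "0 \<le> t" "t < T"
  shows "\<exists>x. q * (T - t) \<le> v x t powr - q"
proof (rule ccontr)
  assume "\<not> ?thesis"
  hence less: "v x t powr - q < q * (T - t)" for x by (auto simp: not_le)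
  have cont_t: "continuous_on {0..period lam} (\<lambda>x. v x t powr - q)"
    using t by (intro continuous_on_inverse_power continuous_intros) auto
  then obtain xm where xm: "\<And>x. x \<in> {0..period lam} \<Longrightarrow> v x t powr - q \<le> v xm t powr - q"
    using continuous_attains_sup[OF compact_Icc _ cont_t] period_pos
    by (metis atLeastatMost_empty_iff2 less_imp_le not_le)
  define \<rho> where "\<rho> = v xm t powr - q / (q * (T - t))"
  \<comment> \<open>Chosen with \<open>\<rho> < r * r\<close>: one factor \<open>r\<close> flattens
    the line, the other moves its zero from \<open>T\<close> back to \<open>S\<close>.\<close>
  define r where "r = (1 + \<rho>) / 2"
  have qT: "q * (T - t) > 0" using q1 t by simp
  have \<rho>: "0 < \<rho>" "\<rho> < 1" using less[of xm] pos[OF t, of xm] qT by (auto simp: \<rho>_def)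
  have r: "0 < r" "r < 1" using \<rho> by (auto simp: r_def)
  have "(1 - \<rho>)\<^sup>2 > 0" using \<rho> by simp
  hence "\<rho> < r * r" by (simp add: r_def power2_eq_square field_simps)
  hence "q * (T - t) * \<rho> < q * (T - t) * (r * r)" using qT by (rule mult_strict_left_mono)
  hence init: "v xm t powr - q < q * (T - t) * (r * r)" using qT t q1 by (simp add: \<rho>_def)
  define S where "S = t + (T - t) * r"
  have "(T - t) * r < (T - t) * 1" "0 < (T - t) * r" using t r by (auto intro!: mult_strict_left_mono simp del: mult_1_right)
  hence S: "t < S" "S < T" by (simp_all add: S_def)
  define Z where "Z = (\<lambda>x s. v x s powr - q - q * r * (S - s))"
  have 1: "compact {0..period lam}" by simp
  have 2: "continuous_on ({0..period lam} \<times> {t..S}) (\<lambda>(x, s). Z x s)"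
    unfolding Z_def case_prod_unfold
    using t S by (intro continuous_on_diff continuous_on_inverse_power continuous_intros) auto
  have 3: "Z x t < 0" if "x \<in> {0..period lam}" for x
    using xm[OF that] init by (simp add: Z_def S_def mult_ac)
  have 4: "0 \<in> {0..period lam}" using period_pos by simp
  have 5: "0 \<le> Z 0 S" by (simp add: Z_def)
  obtain x t1 where x: "x \<in> {0..period lam}" "t < t1" "t1 \<le> S" "Z x t1 = 0"
    "\<And>y. y \<in> {0..period lam} \<Longrightarrow> Z y t1 \<le> 0" "\<And>y s. y \<in> {0..period lam} \<Longrightarrow> t \<le> s \<Longrightarrow> s < t1 \<Longrightarrow> Z y s < 0"
  proof -
    show thesis
    proof (rule first_touching[OF 1 2 _ 4 _ order_refl 5])
      show "Z z t < 0" if "z \<in> {0..period lam}" for z using that by (rule 3)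
      show "t \<le> S" using S by simp
    qed (rule that)
  qed
  have t1: "0 < t1" "t1 < T" "0 \<le> t1" using t x(2,3) S by auto
  have min: "v x t1 \<le> v y t1" for y
  proof -
    obtain y' where y': "y' \<in> {0..period lam}" "\<And>h. v (y' + h) t1 = v (y + h) t1"
      using ex_representative[OF t1(3,2), of y] by blast
    have "v y' t1 powr - q \<le> v x t1 powr - q" using x(4) x(5)[OF y'(1)] by (simp add: Z_def)
    thus ?thesis using inverse_power_le_iff[OF t1(3,2)] y'(2)[of 0] by simp
  qed
  have vp: "v x t1 > 0" using pos[OF t1(3,2)] .
  have "((\<lambda>s. Z x s) has_real_derivative - q * ((v2 x t1 + v x t1) / v x t1) - q * r * (0 - 1)) (at t1)"
    unfolding Z_def by (intro DERIV_diff DERIV_inverse_power t1 DERIV_cmult DERIV_const DERIV_ident)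
  hence "0 \<le> - q * ((v2 x t1 + v x t1) / v x t1) - q * r * (0 - 1)"
    by (rule DERIV_left_max_nonneg[OF _ x(2)]) (use x(4) x(6)[OF x(1)] in \<open>simp add: less_imp_le\<close>)
  moreover have "q * X \<le> q * r" if "0 \<le> - q * X - q * r * (0 - 1)" for X using that by simp
  ultimately have "q * ((v2 x t1 + v x t1) / v x t1) \<le> q * r" by blast
  hence "(v2 x t1 + v x t1) / v x t1 \<le> r"
    by (rule mult_left_le_imp_le) (use q1 in simp)
  moreover have "1 \<le> (v2 x t1 + v x t1) / v x t1"
    using second_derivative_at_min[OF t1(1,2) min] vp by simp
  ultimately show False using r by simp
qed

text \<open>If \<open>v\<close> lay below the profile everywhere, \<open>v powr - q\<close> would
  stay above a line that is still positive at \<open>T\<close>, and \<open>v\<close> would be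
  bounded. The line has slope \<open>- q * r\<close> with \<open>r > 1\<close>, while at a touching
  point, a spatial maximum of \<open>v\<close>, the slope is at least \<open>-q\<close>.\<close>

lemma ex_ge_blowup_profile:
  assumes unbounded: "\<not> (\<exists>M. \<forall>x t. 0 \<le> t \<longrightarrow> t < T \<longrightarrow> v x t \<le> M)" and t: "0 \<le> t" "t < T"
  shows "\<exists>x. v x t powr - q \<le> q * (T - t)"
proof (rule ccontr)
  assume "\<not> ?thesis"
  hence less: "q * (T - t) < v x t powr - q" for x by (auto simp: not_le)
  have cont_t: "continuous_on {0..period lam} (\<lambda>x. v x t powr - q)"
    using t by (intro continuous_on_inverse_power continuous_intros) auto
  then obtain xm where xm: "\<And>x. x \<in> {0..period lam} \<Longrightarrow> v xm t powr - q \<le> v x t powr - q"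
    using continuous_attains_inf[OF compact_Icc _ cont_t] period_pos
    by (metis atLeastatMost_empty_iff2 less_imp_le not_le)
  define \<rho> where "\<rho> = v xm t powr - q / (q * (T - t))"
  \<comment> \<open>The harmonic mean of 1 and \<rho>, so that \<open>1 < r\<close> and
    \<open>r * r < \<rho>\<close>.\<close>
  define r where "r = 2 * \<rho> / (1 + \<rho>)"
  have qT: "q * (T - t) > 0" using q1 t by simp
  have \<rho>: "1 < \<rho>" using less[of xm] qT by (simp add: \<rho>_def)
  have r: "1 < r" using \<rho> by (simp add: r_def)
  have "(1 - \<rho>)\<^sup>2 > 0" using \<rho> by simp
  hence "4 * \<rho> < (1 + \<rho>) * (1 + \<rho>)" by (simp add: power2_eq_square algebra_simps)
  hence "\<rho> * (4 * \<rho>) < \<rho> * ((1 + \<rho>) * (1 + \<rho>))" using \<rho> by (intro mult_strict_left_mono) auto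
  hence "r * r < \<rho>" using \<rho> by (simp add: r_def pos_divide_less_eq mult_ac)
  hence "q * (T - t) * (r * r) < q * (T - t) * \<rho>" using qT by (rule mult_strict_left_mono)
  hence init: "q * (T - t) * (r * r) < v xm t powr - q" using qT t q1 by (simp add: \<rho>_def)
  define S where "S = t + (T - t) * r"
  have "(T - t) * 1 < (T - t) * r" using t r by (intro mult_strict_left_mono) auto
  hence S: "T < S" by (simp add: S_def)
  define Z where "Z = (\<lambda>x s. q * r * (S - s) - v x s powr - q)"
  have barrier: "q * r * (S - s) < v y s powr - q" if s: "t \<le> s" "s < T" for y s
  proof (rule ccontr)
    assume "\<not> ?thesis"
    hence Zy: "0 \<le> Z y s" by (simp add: Z_def)
    have s': "0 \<le> s" "s < T" using s t by auto
    obtain y' where y': "y' \<in> {0..period lam}" "\<And>h. v (y' + h) s = v (y + h) s"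
      using ex_representative[OF s', of y] by blast
    have 1: "compact {0..period lam}" by simp
    have 2: "continuous_on ({0..period lam} \<times> {t..s}) (\<lambda>(x, s). Z x s)"
      unfolding Z_def case_prod_unfold
      using t s by (intro continuous_on_diff continuous_on_inverse_power continuous_intros) auto
    have 3: "Z x t < 0" if "x \<in> {0..period lam}" for x
      using xm[OF that] init by (simp add: Z_def S_def mult_ac)
    have 5: "0 \<le> Z y' s" using Zy y'(2)[of 0] by (simp add: Z_def)
    obtain x t1 where x: "x \<in> {0..period lam}" "t < t1" "t1 \<le> s" "Z x t1 = 0"
      "\<And>y. y \<in> {0..period lam} \<Longrightarrow> Z y t1 \<le> 0" "\<And>y s. y \<in> {0..period lam} \<Longrightarrow> t \<le> s \<Longrightarrow> s < t1 \<Longrightarrow> Z y s < 0"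
    proof -
      show thesis
      proof (rule first_touching[OF 1 2 _ y'(1) s(1) order_refl 5])
        show "Z z t < 0" if "z \<in> {0..period lam}" for z using that by (rule 3)
      qed (rule that)
    qed
    have t1: "0 < t1" "t1 < T" "0 \<le> t1" using t x(2,3) s by auto
    have max: "v y t1 \<le> v x t1" for y
    proof -
      obtain y' where y': "y' \<in> {0..period lam}" "\<And>h. v (y' + h) t1 = v (y + h) t1"
        using ex_representative[OF t1(3,2), of y] by blast
      have "v x t1 powr - q \<le> v y' t1 powr - q" using x(4) x(5)[OF y'(1)] by (simp add: Z_def)
      thus ?thesis using inverse_power_le_iff[OF t1(3,2)] y'(2)[of 0] by simp
    qed
    have vp: "v x t1 > 0" using pos[OF t1(3,2)] .
    have "((\<lambda>s. Z x s) has_real_derivative q * r * (0 - 1) - (- q * ((v2 x t1 + v x t1) / v x t1))) (at t1)"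
      unfolding Z_def by (intro DERIV_diff DERIV_inverse_power t1 DERIV_cmult DERIV_const DERIV_ident)
    hence "0 \<le> q * r * (0 - 1) - (- q * ((v2 x t1 + v x t1) / v x t1))"
      by (rule DERIV_left_max_nonneg[OF _ x(2)]) (use x(4) x(6)[OF x(1)] in \<open>simp add: less_imp_le\<close>)
    moreover have "q * r \<le> q * X" if "0 \<le> q * r * (0 - 1) - (- q * X)" for X using that by simp
    ultimately have "q * r \<le> q * ((v2 x t1 + v x t1) / v x t1)" by blast
    hence "r \<le> (v2 x t1 + v x t1) / v x t1"
      by (rule mult_left_le_imp_le) (use q1 in simp)
    moreover have "(v2 x t1 + v x t1) / v x t1 \<le> 1"
      using second_derivative_at_max[OF t1(1,2) max] vp by simp
    ultimately show False using r by simp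
  qed
  \<comment> \<open>The value of the barrier at \<open>T\<close>, hence a lower bound for
    \<open>v powr - q\<close> on all of [t, T).\<close>
  define \<beta> where "\<beta> = q * r * (S - T)"
  have \<beta>: "\<beta> > 0" using q1 r S by (simp add: \<beta>_def)
  have late: "v x s \<le> \<beta> powr (- 1 / q)" if s: "t \<le> s" "s < T" for x s
  proof -
    have vp: "v x s > 0" using t s by (intro pos) auto
    have "\<beta> \<le> q * r * (S - s)" using q1 r s unfolding \<beta>_def by (intro mult_left_mono) auto
    also have "\<dots> < v x s powr - q" using s by (rule barrier)
    finally have "(v x s powr - q) powr (- 1 / q) \<le> \<beta> powr (- 1 / q)"
      using \<beta> q1 by (intro powr_mono2') auto
    thus ?thesis using vp q1 by (simp add: powr_powr)
  qed
  obtain M where M: "\<And>x s. 0 \<le> s \<Longrightarrow> s \<le> t \<Longrightarrow> v x s \<le> M" using bounded_before[OF t] by blast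
  have "v x s \<le> max M (\<beta> powr (- 1 / q))" if s: "0 \<le> s" "s < T" for x s
    using M[of s x] late[of s x] s by (cases "s \<le> t") auto
  thus False using unbounded by blast
qed

text \<open>The spatially constant solution that blows up at time \<open>T\<close>.\<close>

definition profile :: "real \<Rightarrow> real"
  where "profile t = (q * (T - t)) powr (- 1 / q)"

lemma profile_pos: "t < T \<Longrightarrow> profile t > 0"
  using q1 by (simp add: profile_def)

lemma profile_powr: "t < T \<Longrightarrow> profile t powr q = 1 / (q * (T - t))"
  using q1 powr_minus_divide[of "q * (T - t)" 1] by (simp add: profile_def powr_powr)

lemma DERIV_profile:
  assumes "t < T"
  shows "(profile has_real_derivative profile t / (q * (T - t))) (at t)"
proof -
  have p: "q * (T - t) > 0" using assms q1 by simp
  have "((\<lambda>t. q * (T - t)) has_real_derivative - q) (at t)"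
    by (auto intro!: derivative_eq_intros)
  from DERIV_chain2[OF has_real_derivative_powr[OF p, of "- 1 / q"] this]
  have "(profile has_real_derivative - 1 / q * (q * (T - t)) powr (- 1 / q - 1) * - q) (at t)"
    unfolding profile_def .
  also have "- 1 / q * (q * (T - t)) powr (- 1 / q - 1) * - q = profile t / (q * (T - t))"
    using q1 p by (simp add: profile_def powr_diff)
  finally show ?thesis .
qed

text \<open>The comparisons with constant solutions place the profile between two values of
  \<open>v\<close>, so no value of \<open>v\<close> is farther from it than the oscillation.\<close>

lemma close_to_profile:
  assumes unbounded: "\<not> (\<exists>M. \<forall>x t. 0 \<le> t \<longrightarrow> t < T \<longrightarrow> v x t \<le> M)" and t: "0 \<le> t" "t < T"
    and osc: "\<And>x y. v y t - v x t \<le> D"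
  shows "\<bar>v x t - profile t\<bar> \<le> D"
proof -
  have inv: "v x t = (v x t powr - q) powr (- 1 / q)" for x
    using pos[OF t, of x] q1 by (simp add: powr_powr)
  have p: "q * (T - t) > 0" using q1 t by simp
  obtain y where "q * (T - t) \<le> v y t powr - q" using ex_le_blowup_profile[OF t] by blast
  hence y: "v y t \<le> profile t"
    unfolding profile_def using p q1 by (subst inv) (intro powr_mono2', auto)
  obtain z where "v z t powr - q \<le> q * (T - t)" using ex_ge_blowup_profile[OF unbounded t] by blast
  hence z: "profile t \<le> v z t"
    unfolding profile_def using pos[OF t, of z] q1 by (subst inv) (intro powr_mono2', auto)
  show ?thesis using y z osc[of x y] osc[of z x] by linarith
qed

text \<open>The error constants 3 and 2 come from
  \<open>(1 + \<delta>)^2 \<le> 1 + 3 * \<delta>\<close> and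
  \<open>(1 - \<delta>)^2 \<ge> 1 - 2 * \<delta>\<close>, which apply because
  \<open>q \<le> 2\<close> and \<open>\<delta> \<le> 1\<close>. In the application \<open>c\<close>
  is \<open>\<alpha> * lam^2\<close>.\<close>

lemma growth_rate_le:
  assumes "0 < Y" "0 \<le> \<delta>" "\<delta> \<le> 1" "0 \<le> c" "0 < a" "0 < b"
    and "\<bar>a - Y\<bar> \<le> \<delta> * Y" "\<bar>b - Y\<bar> \<le> \<delta> * Y"
  shows "(1 + q) * a powr q - c * b powr q \<le> Y powr q * (1 + q - c + (3 * (1 + q) + 2 * c) * \<delta>)"
proof -
  have "a powr q \<le> (Y * (1 + \<delta>)) powr q"
    using assms q1 by (intro powr_mono2) (auto simp: algebra_simps)
  also have "\<dots> = Y powr q * (1 + \<delta>) powr q" using assms by (simp add: powr_mult)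
  also have "\<dots> \<le> Y powr q * (1 + 3 * \<delta>)"
  proof (rule mult_left_mono)
    have "(1 + \<delta>) powr q \<le> (1 + \<delta>) powr 2" using assms q2 by (intro powr_mono) auto
    also have "\<dots> = (1 + \<delta>)\<^sup>2" using assms by (simp add: powr_numeral)
    also have "\<dots> \<le> 1 + 3 * \<delta>"
      using assms mult_left_mono[of \<delta> 1 \<delta>] by (simp add: power2_eq_square algebra_simps)
    finally show "(1 + \<delta>) powr q \<le> 1 + 3 * \<delta>" .
  qed simp
  finally have A: "(1 + q) * a powr q \<le> (1 + q) * (Y powr q * (1 + 3 * \<delta>))"
    using q1 by (intro mult_left_mono) auto
  have "Y powr q * (1 - 2 * \<delta>) \<le> Y powr q * (1 - \<delta>) powr q"
  proof (rule mult_left_mono)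
    have "1 - 2 * \<delta> \<le> (1 - \<delta>)\<^sup>2" by (simp add: power2_diff)
    also have "\<dots> = (1 - \<delta>) powr 2" using assms by (cases "\<delta> = 1") (auto simp: powr_numeral)
    also have "\<dots> \<le> (1 - \<delta>) powr q" using assms q2 by (intro powr_mono') auto
    finally show "1 - 2 * \<delta> \<le> (1 - \<delta>) powr q" .
  qed simp
  also have "\<dots> = (Y * (1 - \<delta>)) powr q" using assms by (simp add: powr_mult)
  also have "\<dots> \<le> b powr q"
    using assms q1 by (intro powr_mono2) (auto simp: algebra_simps)
  finally have B: "c * (Y powr q * (1 - 2 * \<delta>)) \<le> c * b powr q"
    using assms by (intro mult_left_mono) auto
  have "(1 + q) * (Y powr q * (1 + 3 * \<delta>)) - c * (Y powr q * (1 - 2 * \<delta>)) =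
    Y powr q * (1 + q - c + (3 * (1 + q) + 2 * c) * \<delta>)"
    by (simp add: algebra_simps)
  thus ?thesis using A B by linarith
qed

text \<open>With \<open>A = profile * B\<close> and
  \<open>profile powr q = 1 / (q * (T - t))\<close>, the growth of the profile itself removes the 1
  from the rate \<open>1 + q - \<alpha> * lam^2\<close>, and a linear inequality for
  \<open>B\<close> remains. \<delta> may be taken from the provisional oscillation bound with factor
  3, which the maximum principle supplies at the touching time.\<close>

lemma normalized_comparison:
  assumes t0: "0 \<le> t0" "t0 < T" and \<alpha>: "0 < \<alpha>" "\<alpha> \<le> 1"
    and B_pos: "\<And>t. t < T \<Longrightarrow> B t > 0"
    and B_deriv: "\<And>t. t < T \<Longrightarrow> (B has_real_derivative B' t) (at t)"
    and init: "\<And>x s. 0 \<le> s \<Longrightarrow> s \<le> pi / lam \<Longrightarrow> v (x + 2 * s) t0 - v x t0 \<le> 2 * (profile t0 * B t0) * sin (lam * s) powr \<alpha>"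
    and super: "\<And>t. t0 < t \<Longrightarrow> t < T \<Longrightarrow> (\<And>x y. v y t - v x t \<le> 3 * (profile t * B t)) \<Longrightarrow>
       \<exists>\<delta>. 0 \<le> \<delta> \<and> \<delta> \<le> 1 \<and> (\<forall>x. \<bar>v x t - profile t\<bar> \<le> \<delta> * profile t) \<and>
         B t * (q - \<alpha> * lam\<^sup>2 + (3 * (1 + q) + 2 * (\<alpha> * lam\<^sup>2)) * \<delta>) \<le> q * (T - t) * B' t"
    and ts: "t0 \<le> t" "t < T"
  shows "v y t - v x t \<le> 2 * (profile t * B t)"
proof -
  have main: "v (x + 2 * s) t - v x t \<le> 2 * (profile t * B t) * sin (lam * s) powr \<alpha>"
    if s: "0 \<le> s" "s \<le> pi / lam" for x s
  proof (rule modulus_comparison[where A = "\<lambda>t. profile t * B t" and A' = "\<lambda>t. profile t / (q * (T - t)) * B t + B' t * profile t", OF t0 \<alpha> _ _ _ _ _ ts s])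
    show "v (x + 2 * s) t0 - v x t0 \<le> 2 * (profile t0 * B t0) * sin (lam * s) powr \<alpha>" if "0 \<le> s" "s \<le> pi / lam" for x s
      using that by (rule init)
    have d: "((\<lambda>t. profile t * B t) has_real_derivative profile t / (q * (T - t)) * B t + B' t * profile t) (at t)" if "t < T" for t
      using that by (intro DERIV_mult DERIV_profile B_deriv)
    show "((\<lambda>t. profile t * B t) has_real_derivative profile t / (q * (T - t)) * B t + B' t * profile t) (at t)" if "t < T" for t
      using that by (rule d)
    show "continuous_on {t0..<T} (\<lambda>t. profile t * B t)"
      by (intro continuous_at_imp_continuous_on ballI DERIV_isCont[OF d]) auto
    show "profile t * B t > 0" if "t < T" for t
      using that by (intro mult_pos_pos profile_pos B_pos)
  next
    fix t x y assume t: "t0 < t" "t < T" and osc: "\<And>x y. v y t - v x t \<le> 3 * (profile t * B t)"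
    obtain \<delta> where \<delta>: "0 \<le> \<delta>" "\<delta> \<le> 1" "\<And>x. \<bar>v x t - profile t\<bar> \<le> \<delta> * profile t"
       "B t * (q - \<alpha> * lam\<^sup>2 + (3 * (1 + q) + 2 * (\<alpha> * lam\<^sup>2)) * \<delta>) \<le> q * (T - t) * B' t"
      using super[OF t osc] by blast
    let ?R = "q - \<alpha> * lam\<^sup>2 + (3 * (1 + q) + 2 * (\<alpha> * lam\<^sup>2)) * \<delta>"
    have p: "q * (T - t) > 0" using q1 t by simp
    have "(1 + q) * v y t powr q - \<alpha> * lam\<^sup>2 * v x t powr q \<le>
      profile t powr q * (1 + q - \<alpha> * lam\<^sup>2 + (3 * (1 + q) + 2 * (\<alpha> * lam\<^sup>2)) * \<delta>)"
      using \<delta>(1-3) \<alpha> t t0 by (intro growth_rate_le profile_pos pos) auto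
    also have "\<dots> = (1 + ?R) / (q * (T - t))"
      unfolding profile_powr[OF t(2)] times_divide_eq_left
      by (intro arg_cong2[where f = "(/)"]) (simp_all add: algebra_simps)
    finally have "profile t * B t * ((1 + q) * v y t powr q - \<alpha> * lam\<^sup>2 * v x t powr q) \<le>
       profile t * B t * ((1 + ?R) / (q * (T - t)))"
      using B_pos[OF t(2)] profile_pos[OF t(2)] by (intro mult_left_mono) auto
    also have "\<dots> = profile t / (q * (T - t)) * (B t + B t * ?R)"
      unfolding times_divide_eq_right times_divide_eq_left
      by (intro arg_cong2[where f = "(/)"]) (simp_all add: algebra_simps)
    also have "\<dots> \<le> profile t / (q * (T - t)) * (B t + q * (T - t) * B' t)"
      using \<delta>(4) p profile_pos[OF t(2)] by (intro mult_left_mono) auto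
    also have "\<dots> = profile t / (q * (T - t)) * B t + B' t * profile t"
      using p t q1 by (simp add: distrib_left)
    finally show "profile t * B t * ((1 + q) * v y t powr q - \<alpha> * lam\<^sup>2 * v x t powr q) \<le>
      profile t / (q * (T - t)) * B t + B' t * profile t" .
  qed
  show ?thesis
  proof (rule oscillation_bound)
    show "0 \<le> t" "t < T" using ts t0 by auto
    fix x s assume s: "0 \<le> s" "s \<le> pi / lam"
    have "sin (lam * s) \<ge> 0"
      using s lam_pos by (intro sin_ge_zero) (auto simp: field_simps)
    hence "sin (lam * s) powr \<alpha> \<le> 1" using \<alpha> by (intro powr_le1) auto
    hence "2 * (profile t * B t) * sin (lam * s) powr \<alpha> \<le> 2 * (profile t * B t) * 1"
      using B_pos[OF ts(2)] profile_pos[OF ts(2)] by (intro mult_left_mono) auto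
    thus "v (x + 2 * s) t - v x t \<le> 2 * (profile t * B t)" using main[OF s, of x] by linarith
  qed
qed

text \<open>Powers of \<open>(T - t) / T\<close> are exponentials in the rescaled time; multiplied
  by \<open>q * (T - t)\<close>, the logarithmic derivative becomes the constant
  \<open>- q * m\<close>.\<close>

lemma DERIV_time_powr:
  assumes "t < T"
  shows "((\<lambda>t. ((T - t) / T) powr m) has_real_derivative - m / (T - t) * ((T - t) / T) powr m) (at t)"
proof -
  have p: "(T - t) / T > 0" using assms T_pos by simp
  have "((\<lambda>t. (T - t) / T) has_real_derivative - 1 / T) (at t)"
    using T_pos by (auto intro!: derivative_eq_intros)
  from DERIV_chain2[OF has_real_derivative_powr[OF p, of m] this]
  show ?thesis using p assms T_pos by (simp add: powr_diff)
qed

text \<open>Being differentiable, \<open>v1\<close> is continuous in space, hence bounded over two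
  periods. The resulting linear bound is compared with the sine by Jordan's inequality: directly for
  \<open>s\<close> in the first half of the range, and in the second half through the distance to
  the next copy of \<open>x\<close>.\<close>

lemma lipschitz_modulus:
  assumes t: "0 < t" "t < T"
  shows "\<exists>M>0. \<forall>x s. 0 \<le> s \<longrightarrow> s \<le> pi / lam \<longrightarrow> v (x + 2 * s) t - v x t \<le> M * sin (lam * s)"
proof -
  let ?L = "period lam"
  have "continuous_on {0..2 * ?L} (\<lambda>x. v1 x t)"
    using dxx[OF t] by (intro continuous_at_imp_continuous_on ballI DERIV_isCont)
  hence "bounded ((\<lambda>x. v1 x t) ` {0..2 * ?L})"
    by (intro compact_imp_bounded compact_continuous_image) auto
  then obtain M where M: "M > 0" "\<And>x. x \<in> {0..2 * ?L} \<Longrightarrow> \<bar>v1 x t\<bar> \<le> M"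
    unfolding bounded_pos by auto
  have lip: "\<bar>v y t - v x t\<bar> \<le> M * (y - x)" if "0 \<le> x" "x \<le> y" "y \<le> 2 * ?L" for x y
  proof -
    have "norm (v y t - v x t) \<le> M * norm (y - x)"
    proof (rule field_differentiable_bound[of "{0..2 * ?L}" _ "\<lambda>x. v1 x t"])
      show "((\<lambda>x. v x t) has_field_derivative v1 z t) (at z within {0..2 * ?L})" for z
        using dx[OF t] by (rule has_field_derivative_at_within)
    qed (use M that in auto)
    thus ?thesis using that by simp
  qed
  have "v (x + 2 * s) t - v x t \<le> (M * pi / lam) * sin (lam * s)" if s: "0 \<le> s" "s \<le> pi / lam" for x s
  proof -
    obtain x' where x': "x' \<in> {0..?L}" "\<And>h. v (x' + h) t = v (x + h) t"
      using ex_representative[of t x] t by (metis less_imp_le)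
    have L: "?L = 2 * (pi / lam)" by (simp add: period_def)
    have "v (x' + 2 * s) t - v x' t \<le> (M * pi / lam) * sin (lam * s)"
    proof (cases "s \<le> pi / lam / 2")
      case True
      have "v (x' + 2 * s) t - v x' t \<le> M * (2 * s)"
        using lip[of x' "x' + 2 * s"] x'(1) s L by auto
      also have "\<dots> = (M * pi / lam) * (2 / pi * (lam * s))" using lam_pos by simp
      also have "\<dots> \<le> (M * pi / lam) * sin (lam * s)"
        using M(1) lam_pos s True by (intro mult_left_mono jordan_inequality) (auto simp: field_simps)
      finally show ?thesis .
    next
      case False
      have "v (x' + ?L) t = v x' t" using v_shift[of t x' 1] t by simp
      moreover have "\<bar>v (x' + ?L) t - v (x' + 2 * s) t\<bar> \<le> M * ((x' + ?L) - (x' + 2 * s))"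
        using x'(1) s L by (intro lip) auto
      ultimately have "v (x' + 2 * s) t - v x' t \<le> M * (?L - 2 * s)" by simp
      also have "\<dots> = (M * pi / lam) * (2 / pi * (pi - lam * s))"
        using lam_pos by (simp add: L field_simps)
      also have "\<dots> \<le> (M * pi / lam) * sin (pi - lam * s)"
        using M(1) lam_pos s False by (intro mult_left_mono jordan_inequality) (auto simp: field_simps)
      finally show ?thesis by simp
    qed
    thus ?thesis using x'(2)[of 0] x'(2)[of "2 * s"] by simp
  qed
  moreover have "M * pi / lam > 0" using M(1) lam_pos by simp
  ultimately show ?thesis by blast
qed

text \<open>The factor \<open>exp (- \<kappa> (1 - t/T)\<^bsup>\<mu>/q\<^esup>)\<close> in the second stage absorbs the error left by the first
  stage without changing the decay rate.\<close>

lemma sharp_decay: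
  assumes unbounded: "\<not> (\<exists>M. \<forall>x t. 0 \<le> t \<longrightarrow> t < T \<longrightarrow> v x t \<le> M)"
    and \<alpha>: "0 < \<alpha>" "\<alpha> \<le> 1" and gap: "q < \<alpha> * lam\<^sup>2"
    and b: "0 < b" "3 * b \<le> 1" "3 * (3 * (1 + q) + 2 * (\<alpha> * lam\<^sup>2)) * b \<le> (\<alpha> * lam\<^sup>2 - q) / 2"
    and init: "\<And>x s. 0 \<le> s \<Longrightarrow> s \<le> pi / lam \<Longrightarrow> v (x + 2 * s) 0 - v x 0 \<le> 2 * (profile 0 * b) * sin (lam * s) powr \<alpha>"
  shows "\<exists>C>0. \<forall>x t. 0 \<le> t \<longrightarrow> t < T \<longrightarrow>
    \<bar>v x t - profile t\<bar> \<le> C * profile t * ((T - t) / T) powr ((lam\<^sup>2 - q) / q)"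
proof -
  \<comment> \<open>Half of the gap between \<open>\<alpha> * lam^2\<close> and \<open>q\<close> is
    left to the error term; the other half yields the provisional decay exponent
    \<open>m\<close>.\<close>
  define \<mu> where "\<mu> = (\<alpha> * lam\<^sup>2 - q) / 2"
  define m where "m = \<mu> / q"
  define \<gamma> where "\<gamma> = (lam\<^sup>2 - q) / q"
  define r where "r = (\<lambda>t. (T - t) / T)"
  define B1 where "B1 = (\<lambda>t. b * r t powr m)"
  have q: "q > 0" using q1 by simp
  have \<mu>: "\<mu> > 0" using gap by (simp add: \<mu>_def)
  have m: "m > 0" "q * m = \<mu>" using \<mu> q by (auto simp: m_def)
  have "\<alpha> * lam\<^sup>2 \<le> 1 * lam\<^sup>2" using \<alpha> by (intro mult_right_mono) auto
  hence \<gamma>: "\<gamma> > 0" "q * \<gamma> = lam\<^sup>2 - q" using gap q by (auto simp: \<gamma>_def)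
  have r: "r t > 0" if "t < T" for t using that T_pos by (simp add: r_def)
  have r1: "r t \<le> 1" if "0 \<le> t" for t using that T_pos by (simp add: r_def)
  have dr: "((\<lambda>t. r t powr a) has_real_derivative - a / (T - t) * r t powr a) (at t)" if "t < T" for t a
    unfolding r_def using that by (rule DERIV_time_powr)
  have B1_pos: "B1 t > 0" if "t < T" for t using r[OF that] b by (simp add: B1_def)
  have B1_le: "B1 t \<le> b" if "0 \<le> t" "t < T" for t
  proof -
    have "r t powr m \<le> 1" using that r[of t] r1[of t] m by (intro powr_le1) auto
    hence "b * r t powr m \<le> b * 1" using b by (intro mult_left_mono) auto
    thus ?thesis by (simp add: B1_def)
  qed
  have close: "\<bar>v x t - profile t\<bar> \<le> D"
    if "0 \<le> t" "t < T" "\<And>x y. v y t - v x t \<le> D" for x t D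
    using close_to_profile[OF unbounded that] .
  have stage1: "v y t - v x t \<le> 2 * (profile t * B1 t)" if t: "0 \<le> t" "t < T" for x y t
  proof (rule normalized_comparison[where B = B1 and B' = "\<lambda>t. b * (- m / (T - t) * r t powr m)", OF order_refl T_pos \<alpha> _ _ _ _ t])
    show "B1 t > 0" if "t < T" for t using that by (rule B1_pos)
    show "(B1 has_real_derivative b * (- m / (T - t) * r t powr m)) (at t)" if "t < T" for t
      unfolding B1_def by (intro DERIV_cmult dr that)
    have "B1 0 = b" using T_pos by (simp add: B1_def r_def)
    thus "v (x + 2 * s) 0 - v x 0 \<le> 2 * (profile 0 * B1 0) * sin (lam * s) powr \<alpha>"
      if "0 \<le> s" "s \<le> pi / lam" for x s using init[OF that] by simp
    fix t assume t: "0 < t" "t < T" and osc: "\<And>x y. v y t - v x t \<le> 3 * (profile t * B1 t)"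
    let ?K = "3 * (1 + q) + 2 * (\<alpha> * lam\<^sup>2)"
    have K: "?K \<ge> 0" using q \<alpha> by simp
    have Bt: "0 < B1 t" "B1 t \<le> b" using B1_pos[of t] B1_le[of t] t by auto
    have aux: "q - \<alpha> * lam\<^sup>2 + X \<le> - \<mu>" if "X \<le> \<mu>" for X
      using that by (simp add: \<mu>_def field_simps)
    have "B1 t * (q - \<alpha> * lam\<^sup>2 + ?K * (3 * B1 t)) \<le> B1 t * (- \<mu>)"
    proof (rule mult_left_mono)
      have "?K * (3 * B1 t) \<le> ?K * (3 * b)" using Bt K by (intro mult_left_mono) auto
      also have "?K * (3 * b) \<le> \<mu>" using b(3) by (simp add: \<mu>_def mult_ac)
      finally show "q - \<alpha> * lam\<^sup>2 + ?K * (3 * B1 t) \<le> - \<mu>" 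
        using aux by blast
    qed (use Bt in simp)
    also have "\<dots> = q * (T - t) * (b * (- m / (T - t) * r t powr m))"
      using t by (simp add: B1_def flip: m(2))
    finally have "B1 t * (q - \<alpha> * lam\<^sup>2 + ?K * (3 * B1 t)) \<le> q * (T - t) * (b * (- m / (T - t) * r t powr m))" .
    \<comment> \<open>The provisional bound with factor 3 gives the relative distance
      \<open>3 * B1 t\<close>, which is at most 1 because \<open>3 * b \<le> 1\<close>.\<close>
    moreover have "\<bar>v x t - profile t\<bar> \<le> 3 * B1 t * profile t" for x
      using close[OF _ t(2) osc, of x] t by (simp add: mult_ac)
    ultimately show "\<exists>\<delta>. 0 \<le> \<delta> \<and> \<delta> \<le> 1 \<and> (\<forall>x. \<bar>v x t - profile t\<bar> \<le> \<delta> * profile t) \<and>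
         B1 t * (q - \<alpha> * lam\<^sup>2 + ?K * \<delta>) \<le> q * (T - t) * (b * (- m / (T - t) * r t powr m))"
      using Bt b(2) by (intro exI[of _ "3 * B1 t"]) auto
  qed
  have close1: "\<bar>v x t - profile t\<bar> \<le> 2 * B1 t * profile t" if t: "0 \<le> t" "t < T" for x t
    using close[OF t stage1[OF t], of x] by (simp add: mult_ac)
  \<comment> \<open>The Lipschitz bound needs spatial derivatives, hence a positive time; any time
    inside (0, T) would serve.\<close>
  define t0 where "t0 = T / 2"
  have t0: "0 < t0" "t0 < T" using T_pos by (auto simp: t0_def)
  define K where "K = 3 * (1 + q) + 2 * (1 * lam\<^sup>2)"
  \<comment> \<open>Chosen so that the exponential factor in \<open>w\<close> contributes exactly
    the error \<open>K * (2 * B1 t)\<close> once its logarithmic derivative is multiplied by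
    \<open>q * (T - t)\<close>.\<close>
  define \<kappa> where "\<kappa> = 2 * K * b / \<mu>"
  have K: "K \<ge> 0" using q by (simp add: K_def)
  have \<kappa>: "\<kappa> \<ge> 0" "\<kappa> * \<mu> = 2 * K * b" using K b \<mu> by (auto simp: \<kappa>_def)
  define w where "w = (\<lambda>t. r t powr \<gamma> * exp (- \<kappa> * r t powr m))"
  have w: "w t > 0" if "t < T" for t using r[OF that] by (simp add: w_def)
  obtain M where M: "M > 0" "\<And>x s. 0 \<le> s \<Longrightarrow> s \<le> pi / lam \<Longrightarrow> v (x + 2 * s) t0 - v x t0 \<le> M * sin (lam * s)"
    using lipschitz_modulus[OF t0] by blast
  \<comment> \<open>Makes the modulus at \<open>t0\<close> equal to the Lipschitz bound.\<close>
  define d where "d = M / (2 * profile t0 * w t0)"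
  have d: "d > 0" "2 * (profile t0 * (d * w t0)) = M"
    using M(1) profile_pos[OF t0(2)] w[OF t0(2)] by (auto simp: d_def)
  let ?w' = "\<lambda>t. w t * (- \<gamma> / (T - t) + \<kappa> * m / (T - t) * r t powr m)"
  have dw: "(w has_real_derivative ?w' t) (at t)" if t: "t < T" for t
  proof -
    have "((\<lambda>t. exp (- \<kappa> * r t powr m)) has_real_derivative exp (- \<kappa> * r t powr m) * (- \<kappa> * (- m / (T - t) * r t powr m))) (at t)"
      by (intro DERIV_fun_exp DERIV_cmult dr t)
    from DERIV_mult[OF dr[OF t, of \<gamma>] this] show ?thesis
      unfolding w_def by (rule DERIV_cong) (simp add: algebra_simps)
  qed
  have stage2: "v y t - v x t \<le> 2 * (profile t * (d * w t))" if t: "t0 \<le> t" "t < T" for x y t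
  proof (rule normalized_comparison[where B = "\<lambda>t. d * w t" and B' = "\<lambda>t. d * ?w' t" and \<alpha> = 1, OF less_imp_le[OF t0(1)] t0(2) _ _ _ _ _ _ t])
    show "d * w t > 0" if "t < T" for t using w[OF that] d by simp
    show "((\<lambda>t. d * w t) has_real_derivative d * ?w' t) (at t)" if "t < T" for t
      by (intro DERIV_cmult dw that)
    show "v (x + 2 * s) t0 - v x t0 \<le> 2 * (profile t0 * (d * w t0)) * sin (lam * s) powr 1"
      if s: "0 \<le> s" "s \<le> pi / lam" for x s
    proof -
      have "sin (lam * s) \<ge> 0"
        using s lam_pos by (intro sin_ge_zero) (auto simp: field_simps)
      thus ?thesis using M(2)[OF s, of x] by (simp only: d(2) powr_one)
    qed
    fix t assume t: "t0 < t" "t < T"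
    have t': "0 \<le> t" using t t0 by simp
    have Bt: "0 < B1 t" "B1 t \<le> b" using B1_pos[of t] B1_le[of t] t t' by auto
    \<comment> \<open>By the choice of \<kappa> the inequality for \<open>d * w\<close> holds with
      equality. The distance from the profile is now taken from the finished first stage, so
      \<delta> is \<open>2 * B1 t\<close>.\<close>
    have "d * w t * (q - 1 * lam\<^sup>2 + K * (2 * B1 t)) = d * w t * (- (q * \<gamma>) + \<kappa> * \<mu> * r t powr m)"
      unfolding \<gamma>(2) \<kappa>(2) B1_def by simp
    also have "\<dots> = d * w t * q * (- \<gamma> + \<kappa> * m * r t powr m)"
      unfolding m(2)[symmetric] by (simp add: algebra_simps)
    also have "- \<gamma> + \<kappa> * m * r t powr m = (T - t) * (- \<gamma> / (T - t) + \<kappa> * m / (T - t) * r t powr m)"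
      using t by (simp add: right_diff_distrib)
    also have "d * w t * q * ((T - t) * (- \<gamma> / (T - t) + \<kappa> * m / (T - t) * r t powr m)) = q * (T - t) * (d * ?w' t)"
      by (simp only: mult_ac)
    finally have "d * w t * (q - 1 * lam\<^sup>2 + K * (2 * B1 t)) \<le> q * (T - t) * (d * ?w' t)" by (rule eq_refl)
    thus "\<exists>\<delta>. 0 \<le> \<delta> \<and> \<delta> \<le> 1 \<and> (\<forall>x. \<bar>v x t - profile t\<bar> \<le> \<delta> * profile t) \<and>
         d * w t * (q - 1 * lam\<^sup>2 + (3 * (1 + q) + 2 * (1 * lam\<^sup>2)) * \<delta>) \<le> q * (T - t) * (d * ?w' t)"
      unfolding K_def[symmetric] using Bt b(2) close1[OF t' t(2)]
      by (intro exI[of _ "2 * B1 t"]) auto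
  qed auto
  \<comment> \<open>The first entry serves from \<open>t0\<close> on; the second serves earlier
    times, when \<open>r t \<ge> 1 / 2\<close> bounds the weight from below.\<close>
  define C where "C = max (2 * d) (2 * b * 2 powr \<gamma>)"
  have C: "C > 0" using d by (simp add: C_def)
  have "\<bar>v x t - profile t\<bar> \<le> C * profile t * r t powr \<gamma>" if t: "0 \<le> t" "t < T" for x t
  proof (cases "t0 \<le> t")
    case True
    have "\<bar>v x t - profile t\<bar> \<le> 2 * (profile t * (d * w t))"
      using close[OF t stage2[OF True t(2)]] .
    also have "\<dots> = 2 * d * (profile t * r t powr \<gamma>) * exp (- \<kappa> * r t powr m)"
      by (simp add: w_def)
    also have "\<dots> \<le> 2 * d * (profile t * r t powr \<gamma>) * 1"
      using d profile_pos[OF t(2)] \<kappa>(1) by (intro mult_left_mono) auto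
    also have "\<dots> \<le> C * (profile t * r t powr \<gamma>)"
      using profile_pos[OF t(2)] unfolding mult_1_right by (intro mult_right_mono) (auto simp: C_def)
    finally show ?thesis by (simp add: mult.assoc)
  next
    case False
    have "1 / 2 \<le> r t" using False T_pos by (simp add: r_def t0_def field_simps)
    hence "(1 / 2) powr \<gamma> \<le> r t powr \<gamma>" using \<gamma> by (intro powr_mono2) auto
    hence "2 powr \<gamma> * (1 / 2) powr \<gamma> \<le> 2 powr \<gamma> * r t powr \<gamma>" by (intro mult_left_mono) auto
    hence one: "1 \<le> 2 powr \<gamma> * r t powr \<gamma>" by (simp flip: powr_mult)
    have "\<bar>v x t - profile t\<bar> \<le> 2 * B1 t * profile t" by (rule close1[OF t])
    also have "\<dots> \<le> 2 * b * profile t * 1"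
      using B1_le[OF t] profile_pos[OF t(2)] by simp
    also have "\<dots> \<le> 2 * b * profile t * (2 powr \<gamma> * r t powr \<gamma>)"
      using one b profile_pos[OF t(2)] by (intro mult_left_mono) auto
    also have "\<dots> = (2 * b * 2 powr \<gamma>) * (profile t * r t powr \<gamma>)" by simp
    also have "\<dots> \<le> C * (profile t * r t powr \<gamma>)"
      using profile_pos[OF t(2)] by (intro mult_right_mono) (auto simp: C_def)
    finally show ?thesis by (simp add: mult.assoc)
  qed
  thus ?thesis using C unfolding r_def \<gamma>_def by blast
qed

end

section \<open>Passage from \<open>k\<close> to \<open>v\<close> and back\<close>

lemma classical_solution_flow:
  assumes p: "p \<ge> 1" and lam: "lam > 0" and T: "T > 0" and sol: "classical_solution p lam \<psi> T k"
  shows "\<exists>v1 v2. curvature_flow lam T ((real p + 1) / real p) (\<lambda>x t. k x t ^ p) v1 v2"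
proof -
  obtain n where n: "p = Suc n" using p by (cases p) auto
  from sol have per: "\<forall>t\<in>{0..<T}. periodic_with (period lam) (\<lambda>\<theta>. k \<theta> t)"
    and pos: "\<forall>\<theta>. \<forall>t\<in>{0..<T}. 0 < k \<theta> t"
    and cont: "continuous_on (UNIV \<times> {0..<T}) (\<lambda>(\<theta>, t). k \<theta> t)"
    unfolding classical_solution_def by blast+
  from sol obtain k1 k2 kt where der: "\<And>\<theta> t. t \<in> {0<..<T} \<Longrightarrow>
        ((\<lambda>x. k x t) has_real_derivative k1 \<theta> t) (at \<theta>) \<and>
        ((\<lambda>x. k1 x t) has_real_derivative k2 \<theta> t) (at \<theta>) \<and>
        ((\<lambda>s. k \<theta> s) has_real_derivative kt \<theta> t) (at t) \<and>
        kt \<theta> t = (k \<theta> t)\<^sup>2 *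
          (k \<theta> t powi (int p - 1) * k2 \<theta> t
           + (real p - 1) * k \<theta> t powi (int p - 2) * (k1 \<theta> t)\<^sup>2
           + 1 / real p * k \<theta> t ^ p)"
    unfolding classical_solution_def by blast
  let ?v1 = "\<lambda>x t. real p * k x t ^ n * k1 x t"
  let ?v2 = "\<lambda>x t. real p * (real n * k x t ^ (n - 1) * k1 x t) * k1 x t + real p * k x t ^ n * k2 x t"
  have "curvature_flow lam T ((real p + 1) / real p) (\<lambda>x t. k x t ^ p) ?v1 ?v2"
  proof
    show "lam > 0" "T > 0" by fact+
    show "1 \<le> (real p + 1) / real p" "(real p + 1) / real p \<le> 2" using p by (auto simp: field_simps)
    show "periodic_with (period lam) (\<lambda>x. k x t ^ p)" if "0 \<le> t" "t < T" for t
      using per that by (auto simp: periodic_with_def)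
    show "0 < k x t ^ p" if "0 \<le> t" "t < T" for x t using pos that by simp
    show "continuous_on (UNIV \<times> {0..<T}) (\<lambda>(x, t). k x t ^ p)"
      using continuous_on_power[OF cont, of p] by (simp add: case_prod_unfold)
    fix x t :: real assume t: "0 < t" "t < T"
    note D = der[of t x]
    have kp: "k x t > 0" using pos t by simp
    show "((\<lambda>x. k x t ^ p) has_real_derivative ?v1 x t) (at x)"
    proof -
      have "((\<lambda>x. k x t) has_real_derivative k1 x t) (at x)" using D t by auto
      from DERIV_power[OF this, of p] show ?thesis by (simp add: n mult_ac)
    qed
    show "((\<lambda>x. ?v1 x t) has_real_derivative ?v2 x t) (at x)"
      using D t by (auto intro!: derivative_eq_intros)
    have "((\<lambda>s. k x s ^ p) has_real_derivative real p * k x t ^ n * kt x t) (at t)"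
    proof -
      have "((\<lambda>s. k x s) has_real_derivative kt x t) (at t)" using D t by auto
      from DERIV_power[OF this, of p] show ?thesis by (simp add: n mult_ac)
    qed
    \<comment> \<open>Multiplying the equation for \<open>k\<close> by \<open>p * k^(p-1)\<close>
      and taking out \<open>k^(p+1)\<close>, which is the \<open>q\<close>-th power of
      \<open>v\<close>, leaves \<open>v'' + v\<close>.\<close>
    moreover have "real p * k x t ^ n * kt x t = (k x t ^ p) powr ((real p + 1) / real p) * (?v2 x t + k x t ^ p)"
    proof -
      have "(k x t ^ p) powr ((real p + 1) / real p) = k x t powr (real (p + 1))"
        unfolding powr_realpow[OF kp, symmetric] powr_powr using p by (simp add: add.commute)
      also have "\<dots> = k x t ^ (p + 1)" using kp by (rule powr_realpow)
      finally have w: "(k x t ^ p) powr ((real p + 1) / real p) = k x t ^ n * (k x t)\<^sup>2"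
        by (simp add: n power2_eq_square mult_ac)
      have 1: "k x t powi (int p - 1) = k x t ^ n" by (simp add: n)
      \<comment> \<open>For \<open>p = 1\<close> the integer exponent is negative and
        \<open>n - 1\<close> is truncated, but both sides carry the factor
        \<open>n = 0\<close>.\<close>
      have 2: "(real p - 1) * k x t powi (int p - 2) = real n * k x t ^ (n - 1)"
      proof (cases n)
        case (Suc n')
        hence "int p - 2 = int n'" by (simp add: n)
        thus ?thesis by (simp add: n Suc)
      qed (simp add: n)
      have "kt x t = (k x t)\<^sup>2 * (k x t ^ n * k2 x t + real n * k x t ^ (n - 1) * (k1 x t)\<^sup>2 + 1 / real p * k x t ^ p)"
        using D t unfolding 1 2 by auto
      thus ?thesis unfolding w using p by (simp add: distrib_left power2_eq_square mult_ac)
    qed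
    ultimately show "((\<lambda>s. k x s ^ p) has_real_derivative (k x t ^ p) powr ((real p + 1) / real p) * (?v2 x t + k x t ^ p)) (at t)"
      by simp
  qed
  thus ?thesis by blast
qed

lemma continuous_on_time_slice:
  assumes "classical_solution p lam \<psi> T k" "0 \<le> t" "t < T"
  shows "continuous_on UNIV (\<lambda>\<theta>. k \<theta> t)"
proof -
  have "continuous_on (UNIV \<times> {0..<T}) (\<lambda>(\<theta>, t). k \<theta> t)"
    using assms by (simp add: classical_solution_def)
  moreover have "continuous_on UNIV (\<lambda>\<theta>::real. (\<theta>, t))" by (intro continuous_intros)
  moreover have "range (\<lambda>\<theta>::real. (\<theta>, t)) \<subseteq> UNIV \<times> {0..<T}" using assms by auto
  ultimately have "continuous_on UNIV (\<lambda>\<theta>. case (\<theta>, t) of (\<theta>, t) \<Rightarrow> k \<theta> t)"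
    by (rule continuous_on_compose2)
  thus ?thesis by simp
qed

lemma power_diff_abs_le:
  fixes a b Y :: real
  assumes "0 \<le> a" "a \<le> Y" "0 \<le> b" "b \<le> Y"
  shows "\<bar>b ^ Suc n - a ^ Suc n\<bar> \<le> real (Suc n) * Y ^ n * \<bar>b - a\<bar>"
proof (induction n)
  case (Suc n)
  have "b ^ Suc (Suc n) - a ^ Suc (Suc n) = b * (b ^ Suc n - a ^ Suc n) + (b - a) * a ^ Suc n"
    by (simp add: algebra_simps)
  hence "\<bar>b ^ Suc (Suc n) - a ^ Suc (Suc n)\<bar> \<le> \<bar>b * (b ^ Suc n - a ^ Suc n)\<bar> + \<bar>(b - a) * a ^ Suc n\<bar>"
    by linarith
  also have "\<dots> = b * \<bar>b ^ Suc n - a ^ Suc n\<bar> + \<bar>b - a\<bar> * a ^ Suc n"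
    using assms by (simp add: abs_mult)
  also have "\<dots> \<le> Y * (real (Suc n) * Y ^ n * \<bar>b - a\<bar>) + \<bar>b - a\<bar> * Y ^ Suc n"
    using assms Suc by (intro add_mono mult_mono power_mono mult_left_mono) auto
  also have "\<dots> = real (Suc (Suc n)) * Y ^ Suc n * \<bar>b - a\<bar>"
    by (simp add: algebra_simps)
  finally show ?case .
qed auto

text \<open>Raising to a power moves a nonnegative number away from 1 on its own side. An estimate
  for \<open>u ^ p\<close>, the quotient of \<open>v\<close> and the profile, thus passes to
  \<open>u\<close> at the same rate.\<close>

lemma abs_diff_one_le_power:
  fixes u :: real
  assumes "0 \<le> u" "p \<ge> 1"
  shows "\<bar>u - 1\<bar> \<le> \<bar>u ^ p - 1\<bar>"
proof (cases "u \<ge> 1")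
  case True
  thus ?thesis using self_le_power[of u p] assms by auto
next
  case False
  thus ?thesis using power_le_one[of u] power_decreasing[of 1 p u] assms by auto
qed

text \<open>The factor 2 arises because real and imaginary parts are bounded separately.\<close>

lemma fourier_norm2_bound:
  assumes "fourier_norm2 lam f < \<infinity>"
  obtains N where "fourier_norm2 lam f = ereal N" "N \<ge> 0"
    "\<And>n. n \<noteq> 0 \<Longrightarrow> (of_int n)\<^sup>2 * norm (fourier_coeff lam f n) \<le> 2 * N"
proof -
  have Re: "ereal ((of_int n)\<^sup>2 * \<bar>Re (fourier_coeff lam f n)\<bar>) \<le> fourier_norm2 lam f" if "n \<noteq> 0" for n
    unfolding fourier_norm2_def using that by (intro max.coboundedI1 SUP_upper2[of n]) auto
  have Im: "ereal ((of_int n)\<^sup>2 * \<bar>Im (fourier_coeff lam f n)\<bar>) \<le> fourier_norm2 lam f" if "n \<noteq> 0" for n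
    unfolding fourier_norm2_def using that by (intro max.coboundedI2 SUP_upper2[of n]) auto
  have "0 \<le> ereal ((of_int 1)\<^sup>2 * \<bar>Re (fourier_coeff lam f 1)\<bar>)" by simp
  also have "\<dots> \<le> fourier_norm2 lam f" by (rule Re) simp
  finally have nonneg: "0 \<le> fourier_norm2 lam f" .
  then obtain N where N: "fourier_norm2 lam f = ereal N"
    using assms by (cases "fourier_norm2 lam f") auto
  show ?thesis
  proof (rule that[OF N])
    show "N \<ge> 0" using nonneg N by simp
    fix n :: int assume n: "n \<noteq> 0"
    have "(of_int n)\<^sup>2 * norm (fourier_coeff lam f n) \<le>
      (of_int n)\<^sup>2 * (\<bar>Re (fourier_coeff lam f n)\<bar> + \<bar>Im (fourier_coeff lam f n)\<bar>)"
      by (intro mult_left_mono cmod_le) auto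
    also have "\<dots> \<le> 2 * N" using Re[OF n] Im[OF n] by (simp add: N distrib_left)
    finally show "(of_int n)\<^sup>2 * norm (fourier_coeff lam f n) \<le> 2 * N" .
  qed
qed

text \<open>\<open>m\<close> stands for the mean of \<psi>. Since \<open>\<psi> \<ge> m / 2\<close>
  and \<open>v\<close> at time 0 does not exceed the profile everywhere, \<open>profile 0\<close> is
  at least \<open>(m / 2) ^ p\<close>. A modulus that is small against the mean is therefore small
  against the profile, whatever the blow-up time.\<close>

lemma flow_decay:
  assumes p: "p \<ge> 1" and lam: "lam > 0" and T: "T > 0"
    and sol: "classical_solution p lam \<psi> T k" and blowup: "blows_up_at T k"
    and q_def: "q = (real p + 1) / real p"
    and \<alpha>: "0 < \<alpha>" "\<alpha> \<le> 1" and gap: "q < \<alpha> * lam\<^sup>2"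
    and b: "0 < b" "3 * b \<le> 1" "3 * (3 * (1 + q) + 2 * (\<alpha> * lam\<^sup>2)) * b \<le> (\<alpha> * lam\<^sup>2 - q) / 2"
    and m: "m > 0" "\<And>x. m / 2 \<le> \<psi> x"
    and init: "\<And>x s. 0 \<le> s \<Longrightarrow> s \<le> pi / lam \<Longrightarrow>
      \<psi> (x + 2 * s) ^ p - \<psi> x ^ p \<le> 2 * ((m / 2) ^ p * b) * sin (lam * s) powr \<alpha>"
  shows "\<exists>C>0. \<forall>x t. 0 \<le> t \<longrightarrow> t < T \<longrightarrow>
    \<bar>(q * (T - t)) powr (1 / q) * k x t ^ p - 1\<bar> \<le> C * ((T - t) / T) powr ((lam\<^sup>2 - q) / q)"
proof -
  obtain v1 v2 where "curvature_flow lam T ((real p + 1) / real p) (\<lambda>x t. k x t ^ p) v1 v2"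
    using classical_solution_flow[OF p lam T sol] by blast
  then interpret curvature_flow lam T q "\<lambda>x t. k x t ^ p" v1 v2 unfolding q_def .
  have start: "k x 0 = \<psi> x" for x using sol by (simp add: classical_solution_def)
  have kpos: "0 < k x t" if "0 \<le> t" "t < T" for x t
    using sol that by (simp add: classical_solution_def)
  have unbounded: "\<not> (\<exists>M. \<forall>x t. 0 \<le> t \<longrightarrow> t < T \<longrightarrow> k x t ^ p \<le> M)"
  proof
    assume "\<exists>M. \<forall>x t. 0 \<le> t \<longrightarrow> t < T \<longrightarrow> k x t ^ p \<le> M"
    then obtain M where M: "\<And>x t. 0 \<le> t \<Longrightarrow> t < T \<Longrightarrow> k x t ^ p \<le> M" by blast
    \<comment> \<open>A bound for \<open>k ^ p\<close> bounds \<open>k\<close>, since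
      \<open>k \<le> k ^ p\<close> once \<open>k \<ge> 1\<close>.\<close>
    have "k x t \<le> max 1 M" if t: "0 \<le> t" "t < T" for x t
      using M[OF t, of x] self_le_power[of "k x t" p] p by (cases "1 \<le> k x t") auto
    hence "bdd_above ((\<lambda>(\<theta>, t). k \<theta> t) ` (UNIV \<times> {0..<T}))"
      by (intro bdd_aboveI2[of _ _ "max 1 M"]) auto
    thus False using blowup by (simp add: blows_up_at_def)
  qed
  obtain x0 where x0: "q * (T - 0) \<le> (k x0 0 ^ p) powr - q"
    using ex_le_blowup_profile[of 0] T by auto
  have inv: "k x0 0 ^ p = ((k x0 0 ^ p) powr - q) powr (- 1 / q)"
    using pos[of 0 x0] T q1 by (simp add: powr_powr)
  have "(m / 2) ^ p \<le> k x0 0 ^ p" unfolding start using m by (intro power_mono) auto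
  also have "\<dots> \<le> profile 0"
    unfolding profile_def using x0 T q1 by (subst inv) (intro powr_mono2', auto)
  finally have base: "(m / 2) ^ p \<le> profile 0" .
  have "\<exists>C>0. \<forall>x t. 0 \<le> t \<longrightarrow> t < T \<longrightarrow>
    \<bar>k x t ^ p - profile t\<bar> \<le> C * profile t * ((T - t) / T) powr ((lam\<^sup>2 - q) / q)"
  proof (rule sharp_decay[OF unbounded \<alpha> gap b])
    fix x s assume s: "0 \<le> s" "s \<le> pi / lam"
    have "k (x + 2 * s) 0 ^ p - k x 0 ^ p \<le> 2 * ((m / 2) ^ p * b) * sin (lam * s) powr \<alpha>"
      unfolding start using init[OF s] .
    also have "\<dots> \<le> 2 * (profile 0 * b) * sin (lam * s) powr \<alpha>"
      using base b by (intro mult_right_mono mult_left_mono) auto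
    finally show "k (x + 2 * s) 0 ^ p - k x 0 ^ p \<le> 2 * (profile 0 * b) * sin (lam * s) powr \<alpha>" .
  qed
  then obtain C where C: "C > 0" "\<And>x t. 0 \<le> t \<Longrightarrow> t < T \<Longrightarrow>
    \<bar>k x t ^ p - profile t\<bar> \<le> C * profile t * ((T - t) / T) powr ((lam\<^sup>2 - q) / q)" by blast
  have "\<bar>(q * (T - t)) powr (1 / q) * k x t ^ p - 1\<bar> \<le> C * ((T - t) / T) powr ((lam\<^sup>2 - q) / q)"
    if t: "0 \<le> t" "t < T" for x t
  proof -
    have Y: "profile t > 0" using t by (intro profile_pos)
    have "(q * (T - t)) powr (1 / q) = 1 / profile t"
      unfolding profile_def by (simp add: powr_minus_divide)
    hence "(q * (T - t)) powr (1 / q) * k x t ^ p - 1 = (k x t ^ p - profile t) / profile t"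
      using Y by (simp add: diff_divide_distrib)
    hence "\<bar>(q * (T - t)) powr (1 / q) * k x t ^ p - 1\<bar> = \<bar>k x t ^ p - profile t\<bar> / profile t"
      using Y by (simp add: abs_divide)
    also have "\<dots> \<le> C * ((T - t) / T) powr ((lam\<^sup>2 - q) / q)"
      using C(2)[OF t, of x] Y by (simp add: pos_divide_le_eq mult_ac)
    finally show ?thesis .
  qed
  thus ?thesis using C(1) by blast
qed

text \<open>The prefactor in \<open>u\<close> is such that \<open>u ^ p\<close> is the quotient of
  \<open>v\<close> and the profile. The exponents match because
  \<open>(lam^2 - q) / q * (p + 1) = lam^2 * p - p - 1\<close>.\<close>

lemma normalized_solution_decay:
  assumes p: "p \<ge> 1" and T: "T > 0" and sol: "classical_solution p lam \<psi> T k"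
    and u: "normalized_solution p T k u" and q_def: "q = (real p + 1) / real p"
    and decay: "\<And>x t. 0 \<le> t \<Longrightarrow> t < T \<Longrightarrow>
      \<bar>(q * (T - t)) powr (1 / q) * k x t ^ p - 1\<bar> \<le> C * ((T - t) / T) powr ((lam\<^sup>2 - q) / q)"
    and \<tau>: "\<tau> \<ge> 0"
  shows "Linfty_norm {0..period lam} (\<lambda>\<theta>. u \<theta> \<tau> - 1)
        \<le> ereal (C * exp (- (lam\<^sup>2 * real p - real p - 1) * \<tau>))"
proof -
  \<comment> \<open>The inverse of the time change \<open>rescaled_time\<close>.\<close>
  define t where "t = T * (1 - exp (- ((real p + 1) * \<tau>)))"
  have frac: "(T - t) / T = exp (- ((real p + 1) * \<tau>))"
    using T by (simp add: t_def field_simps)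
  have t: "0 \<le> t" "t < T" using T \<tau> by (auto simp: t_def)
  have "1 - t / T = exp (- ((real p + 1) * \<tau>))" using frac T by (simp add: diff_divide_distrib)
  hence resc: "rescaled_time p T t = \<tau>" by (simp add: rescaled_time_def)
  have q: "q > 0" using p by (simp add: q_def)
  define w where "w = (q * (T - t)) powr (1 / (real p + 1))"
  have u_eq: "u \<theta> \<tau> = w * k \<theta> t" for \<theta>
  proof -
    have "u \<theta> (rescaled_time p T t) = ((real p + 1) / real p) powr (1 / (real p + 1)) *
      (T - t) powr (1 / (real p + 1)) * k \<theta> t"
      using u t unfolding normalized_solution_def by simp
    thus ?thesis using t q by (simp add: resc w_def powr_mult flip: q_def)
  qed
  have wp: "w ^ p = (q * (T - t)) powr (1 / q)"
  proof -
    have "w ^ p = w powr real p" using t q by (simp add: w_def powr_realpow)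
    also have "\<dots> = (q * (T - t)) powr (1 / q)"
      unfolding w_def powr_powr by (simp add: q_def)
    finally show ?thesis .
  qed
  have expo: "((T - t) / T) powr ((lam\<^sup>2 - q) / q) = exp (- (lam\<^sup>2 * real p - real p - 1) * \<tau>)"
  proof -
    have "(lam\<^sup>2 - q) / q * (real p + 1) = lam\<^sup>2 * real p - real p - 1"
    proof -
      have "(real p + 1) / q = real p" "q * real p = real p + 1" using p by (auto simp: q_def)
      moreover have "(lam\<^sup>2 - q) / q * (real p + 1) = (lam\<^sup>2 - q) * ((real p + 1) / q)" by simp
      ultimately show ?thesis by (simp add: left_diff_distrib)
    qed
    hence "(lam\<^sup>2 - q) / q * (- ((real p + 1) * \<tau>)) = - (lam\<^sup>2 * real p - real p - 1) * \<tau>"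
      by (metis mult.assoc mult_minus_left mult_minus_right)
    thus ?thesis unfolding frac powr_def by simp
  qed
  have bound: "\<bar>u \<theta> \<tau> - 1\<bar> \<le> C * exp (- (lam\<^sup>2 * real p - real p - 1) * \<tau>)" for \<theta>
  proof -
    have "0 < k \<theta> t" using sol t by (simp add: classical_solution_def)
    hence "0 \<le> u \<theta> \<tau>" by (simp add: u_eq w_def)
    hence "\<bar>u \<theta> \<tau> - 1\<bar> \<le> \<bar>u \<theta> \<tau> ^ p - 1\<bar>" using p by (rule abs_diff_one_le_power)
    also have "\<dots> = \<bar>(q * (T - t)) powr (1 / q) * k \<theta> t ^ p - 1\<bar>"
      by (simp add: u_eq power_mult_distrib wp)
    also have "\<dots> \<le> C * ((T - t) / T) powr ((lam\<^sup>2 - q) / q)" using decay[OF t] .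
    finally show ?thesis unfolding expo .
  qed
  \<comment> \<open>Continuity in space supplies the measurability that \<open>esssup_I\<close> asks
    for.\<close>
  have "continuous_on UNIV (\<lambda>\<theta>. k \<theta> t)" by (rule continuous_on_time_slice[OF sol t])
  hence "continuous_on {0..period lam} (\<lambda>\<theta>. k \<theta> t)" by (rule continuous_on_subset) simp
  hence "continuous_on {0..period lam} (\<lambda>\<theta>. \<bar>u \<theta> \<tau> - 1\<bar>)"
    unfolding u_eq by (intro continuous_intros)
  hence "(\<lambda>\<theta>. \<bar>u \<theta> \<tau> - 1\<bar>) \<in> borel_measurable (lebesgue_on {0..period lam})"
    by (intro continuous_imp_measurable_on_sets_lebesgue) auto
  thus ?thesis unfolding Linfty_norm_def
    using bound by (intro esssup_I borel_measurable_ereal AE_I2) auto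
qed

text \<open>\<open>H\<close> combines the factor 4 of the Hoelder estimate with the factor 2 from
  passing to complex norms; the added 1 keeps it positive. \<open>H\<close> times the norm bounds
  the oscillation, \<open>c \<ge> 2 * H\<close> makes this at most half the mean, and dividing the
  mean condition by \<open>c\<close> replaces the norm by a small multiple of the mean.\<close>

lemma small_oscillation_of_fourier_norm2:
  assumes lam: "lam > 0" and \<alpha>: "0 < \<alpha>" "\<alpha> < 1"
    and cont: "continuous_on UNIV \<psi>" and per: "periodic_with (period lam) \<psi>"
    and pos: "\<And>\<theta>. 0 < \<psi> \<theta>" and fin: "fourier_norm2 lam \<psi> < \<infinity>"
    and H: "H = 8 * (\<Sum>n. real n powr (\<alpha> - 2)) + 1"
    and c: "c > 0" "c \<ge> 2 * H"
    and mean: "ereal (mean_value lam \<psi>) \<ge> ereal c * fourier_norm2 lam \<psi>"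
  shows "mean_value lam \<psi> > 0"
    and "\<bar>\<psi> x - mean_value lam \<psi>\<bar> \<le> mean_value lam \<psi> / 2"
    and "\<bar>\<psi> y - \<psi> x\<bar> \<le> H * (mean_value lam \<psi> / c) * \<bar>sin (lam * (y - x) / 2)\<bar> powr \<alpha>"
proof -
  let ?m = "mean_value lam \<psi>"
  obtain N where N: "fourier_norm2 lam \<psi> = ereal N" "N \<ge> 0"
    "\<And>n. n \<noteq> 0 \<Longrightarrow> (of_int n)\<^sup>2 * norm (fourier_coeff lam \<psi> n) \<le> 2 * N"
  proof -
    show thesis by (rule fourier_norm2_bound[OF fin], rule that)
  qed
  have S: "(\<Sum>n. real n powr (\<alpha> - 2)) \<ge> 0"
    using \<alpha> by (intro suminf_nonneg) (auto simp: summable_real_powr_iff)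
  hence "H > 0" by (simp add: H)
  have mN: "c * N \<le> ?m" using mean by (simp add: N(1))
  have hoelder: "\<bar>\<psi> y - \<psi> x\<bar> \<le> H * N * \<bar>sin (lam * (y - x) / 2)\<bar> powr \<alpha>" for x y
  proof -
    have "\<bar>\<psi> y - \<psi> x\<bar> \<le> 4 * (2 * N) * (\<Sum>n. real n powr (\<alpha> - 2)) * \<bar>sin (lam * (y - x) / 2)\<bar> powr \<alpha>"
      by (rule hoelder_of_fourier_decay[OF lam cont per \<alpha>], rule N(3))
    also have "\<dots> \<le> H * N * \<bar>sin (lam * (y - x) / 2)\<bar> powr \<alpha>"
      using N(2) by (intro mult_right_mono) (auto simp: H algebra_simps)
    finally show ?thesis .
  qed
  have osc: "\<bar>\<psi> y - \<psi> x\<bar> \<le> H * N" for x y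
  proof -
    have "\<bar>sin (lam * (y - x) / 2)\<bar> powr \<alpha> \<le> 1" using \<alpha> by (intro powr_le1) auto
    hence "H * N * \<bar>sin (lam * (y - x) / 2)\<bar> powr \<alpha> \<le> H * N * 1"
      using \<open>H > 0\<close> N(2) by (intro mult_left_mono) auto
    thus ?thesis using hoelder[of y x] by simp
  qed
  have close: "\<bar>\<psi> x - ?m\<bar> \<le> H * N" for x by (rule mean_value_close[OF lam cont osc])
  have "2 * H * N \<le> c * N" using c N(2) by (intro mult_right_mono) auto
  hence half: "H * N \<le> ?m / 2" using mN by simp
  thus "\<bar>\<psi> x - ?m\<bar> \<le> ?m / 2" using close[of x] by simp
  \<comment> \<open>\<open>0 < \<psi> 0\<close>, and \<psi> at 0 is at most 3/2 times the
    mean.\<close>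
  show m: "?m > 0" using pos[of 0] close[of 0] half by linarith
  have "N \<le> ?m / c" using mN c by (simp add: field_simps)
  hence "H * N * \<bar>sin (lam * (y - x) / 2)\<bar> powr \<alpha> \<le> H * (?m / c) * \<bar>sin (lam * (y - x) / 2)\<bar> powr \<alpha>"
    using \<open>H > 0\<close> by (intro mult_right_mono mult_left_mono) auto
  thus "\<bar>\<psi> y - \<psi> x\<bar> \<le> H * (?m / c) * \<bar>sin (lam * (y - x) / 2)\<bar> powr \<alpha>"
    using hoelder[of y x] by linarith
qed

theorem proposition3p1:
  fixes p :: nat and lam :: real
  assumes "p \<ge> 1" and "lam > sqrt ((real p + 2) / real p)"
  shows "\<exists>c>0. \<forall>(\<psi> :: real \<Rightarrow> real) (T :: real) (k :: real \<Rightarrow> real \<Rightarrow> real) (u :: real \<Rightarrow> real \<Rightarrow> real).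
    (\<forall>\<theta>. 0 < \<psi> \<theta>) \<longrightarrow>
    periodic_with (period lam) \<psi> \<longrightarrow>
    fourier_norm2 lam \<psi> < \<infinity> \<longrightarrow>
    ereal (mean_value lam \<psi>) \<ge> ereal c * fourier_norm2 lam \<psi> \<longrightarrow>
    maximal_solution p lam \<psi> T k \<longrightarrow>
    blows_up_at T k \<longrightarrow>
    normalized_solution p T k u \<longrightarrow>
    (\<exists>C>0. \<forall>\<tau>\<ge>0.
      Linfty_norm {0..period lam} (\<lambda>\<theta>. u \<theta> \<tau> - 1)
        \<le> ereal (C * exp (- (lam\<^sup>2 * real p - real p - 1) * \<tau>)))"
proof -
  \<comment> \<open>The exponent with \<open>\<alpha> * ((p + 2) / p) = q\<close>: the hypothesis on
    \<open>lam\<close> then gives \<open>\<alpha> * lam^2 > q\<close>, while \<alpha> < 1 keeps the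
    sum of \<open>n powr (\<alpha> - 2)\<close> finite.\<close>
  define \<alpha> where "\<alpha> = (real p + 1) / (real p + 2)"
  define q where "q = (real p + 1) / real p"
  define K where "K = 3 * (3 * (1 + q) + 2 * (\<alpha> * lam\<^sup>2))"
  define \<mu> where "\<mu> = (\<alpha> * lam\<^sup>2 - q) / 2"
  \<comment> \<open>The largest first-stage amplitude compatible with \<open>3 * b \<le> 1\<close>
    and \<open>K * b \<le> \<mu>\<close>.\<close>
  define b where "b = min (1 / 3) (\<mu> / K)"
  define H where "H = 8 * (\<Sum>n. real n powr (\<alpha> - 2)) + 1"
  \<comment> \<open>The first summand keeps the oscillation of \<psi> below half its mean; the
    second gives \<open>p * 3^(p-1) * H \<le> c * b\<close>, which the initial modulus of
    \<open>\<psi> ^ p\<close> requires. Only \<open>p\<close> and \<open>lam\<close> enter.\<close>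
  define c where "c = 2 * H + real p * 3 ^ (p - 1) * H / b"
  have "0 \<le> sqrt ((real p + 2) / real p)" by simp
  hence lam: "lam > 0" using assms(2) by linarith
  have \<alpha>: "0 < \<alpha>" "\<alpha> < 1" by (auto simp: \<alpha>_def)
  have "q > 0" using assms(1) by (simp add: q_def)
  have "(sqrt ((real p + 2) / real p))\<^sup>2 < lam\<^sup>2" using assms(2) by (intro power_strict_mono) auto
  hence "(real p + 2) / real p < lam\<^sup>2" by simp
  hence "\<alpha> * ((real p + 2) / real p) < \<alpha> * lam\<^sup>2" using \<alpha> by (intro mult_strict_left_mono)
  moreover have "\<alpha> * ((real p + 2) / real p) = q" by (simp add: \<alpha>_def q_def)
  ultimately have gap: "q < \<alpha> * lam\<^sup>2" by simp
  hence \<mu>: "\<mu> > 0" by (simp add: \<mu>_def)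
  have K: "K > 0" using \<open>q > 0\<close> gap by (simp add: K_def)
  have b: "0 < b" "3 * b \<le> 1" "K * b \<le> \<mu>"
  proof -
    show "0 < b" "3 * b \<le> 1" using \<mu> K by (auto simp: b_def)
    have "K * b \<le> K * (\<mu> / K)" using K by (intro mult_left_mono) (auto simp: b_def)
    thus "K * b \<le> \<mu>" using K by simp
  qed
  have "(\<Sum>n. real n powr (\<alpha> - 2)) \<ge> 0"
    using \<alpha> by (intro suminf_nonneg) (auto simp: summable_real_powr_iff)
  hence H: "H > 0" by (simp add: H_def)
  have extra: "real p * 3 ^ (p - 1) * H / b \<ge> 0" using H b by simp
  have c: "c > 0" "c \<ge> 2 * H" using H extra by (auto simp: c_def)
  have cb: "real p * 3 ^ (p - 1) * H \<le> c * b"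
  proof -
    have "c * b = 2 * H * b + real p * 3 ^ (p - 1) * H" using b by (simp add: c_def distrib_right)
    thus ?thesis using H b by simp
  qed
  show ?thesis
  proof (rule exI[of _ c], intro conjI allI impI c(1))
    fix \<psi> :: "real \<Rightarrow> real" and T :: real and k u :: "real \<Rightarrow> real \<Rightarrow> real"
    assume pos: "\<forall>\<theta>. 0 < \<psi> \<theta>" and per: "periodic_with (period lam) \<psi>"
      and fin: "fourier_norm2 lam \<psi> < \<infinity>"
      and mean: "ereal (mean_value lam \<psi>) \<ge> ereal c * fourier_norm2 lam \<psi>"
      and max: "maximal_solution p lam \<psi> T k" and blowup: "blows_up_at T k"
      and u: "normalized_solution p T k u"
    have T: "T > 0" and sol: "classical_solution p lam \<psi> T k"
      using max by (auto simp: maximal_solution_def)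
    have cont: "continuous_on UNIV \<psi>"
      using continuous_on_time_slice[OF sol order_refl T] sol by (simp add: classical_solution_def)
    let ?m = "mean_value lam \<psi>"
    have pos': "0 < \<psi> \<theta>" for \<theta> using pos by simp
    note small = small_oscillation_of_fourier_norm2[OF lam \<alpha> cont per pos' fin H_def c mean]
    have m: "?m > 0" by (rule small(1))
    have near: "?m / 2 \<le> \<psi> x" "\<psi> x \<le> 3 / 2 * ?m" for x using small(2)[of x] by linarith+
    have init: "\<psi> (x + 2 * s) ^ p - \<psi> x ^ p \<le> 2 * ((?m / 2) ^ p * b) * sin (lam * s) powr \<alpha>"
      if s: "0 \<le> s" "s \<le> pi / lam" for x s
    proof -
      obtain n where n: "p = Suc n" using assms(1) by (cases p) auto
      have "sin (lam * s) \<ge> 0"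
        using s lam by (intro sin_ge_zero) (auto simp: field_simps)
      hence hoelder: "\<bar>\<psi> (x + 2 * s) - \<psi> x\<bar> \<le> H * (?m / c) * sin (lam * s) powr \<alpha>"
        using small(3)[of "x + 2 * s" x] by simp
      have "\<psi> (x + 2 * s) ^ p - \<psi> x ^ p \<le> real p * (3 / 2 * ?m) ^ n * \<bar>\<psi> (x + 2 * s) - \<psi> x\<bar>"
        using power_diff_abs_le[of "\<psi> x" "3 / 2 * ?m" "\<psi> (x + 2 * s)" n] near pos'
        unfolding n by (simp add: less_imp_le del: power_Suc)
      also have "\<dots> \<le> real p * (3 / 2 * ?m) ^ n * (H * (?m / c) * sin (lam * s) powr \<alpha>)"
        using m by (intro mult_left_mono hoelder) auto
      \<comment> \<open>One factor of the mean from the Hoelder bound and \<open>p - 1\<close>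
        factors from the power combine to twice the \<open>p\<close>-th power of half the mean, with
        \<open>3 ^ (p - 1)\<close> left over.\<close>
      also have "\<dots> = 2 * ((?m / 2) ^ p * (real p * 3 ^ (p - 1) * H / c)) * sin (lam * s) powr \<alpha>"
        by (simp add: n power_mult_distrib power_divide)
      also have "\<dots> \<le> 2 * ((?m / 2) ^ p * b) * sin (lam * s) powr \<alpha>"
        using cb c(1) m by (intro mult_right_mono mult_left_mono) (auto simp: pos_divide_le_eq mult_ac)
      finally show ?thesis .
    qed
    have "\<exists>C>0. \<forall>x t. 0 \<le> t \<longrightarrow> t < T \<longrightarrow>
      \<bar>(q * (T - t)) powr (1 / q) * k x t ^ p - 1\<bar> \<le> C * ((T - t) / T) powr ((lam\<^sup>2 - q) / q)"
      using init by (rule flow_decay[OF assms(1) lam T sol blowup q_def \<alpha>(1) less_imp_le[OF \<alpha>(2)] gap b(1,2) b(3)[unfolded K_def \<mu>_def] m near(1)])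
    then obtain C where C: "C > 0" "\<And>x t. 0 \<le> t \<Longrightarrow> t < T \<Longrightarrow>
      \<bar>(q * (T - t)) powr (1 / q) * k x t ^ p - 1\<bar> \<le> C * ((T - t) / T) powr ((lam\<^sup>2 - q) / q)"
      by blast
    show "\<exists>C>0. \<forall>\<tau>\<ge>0. Linfty_norm {0..period lam} (\<lambda>\<theta>. u \<theta> \<tau> - 1)
        \<le> ereal (C * exp (- (lam\<^sup>2 * real p - real p - 1) * \<tau>))"
    proof (intro exI[of _ C] conjI allI impI C(1))
      fix \<tau> :: real assume "\<tau> \<ge> 0"
      thus "Linfty_norm {0..period lam} (\<lambda>\<theta>. u \<theta> \<tau> - 1)
        \<le> ereal (C * exp (- (lam\<^sup>2 * real p - real p - 1) * \<tau>))"
        by (intro normalized_solution_decay[OF assms(1) T sol u q_def] C(2))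
    qed
  qed
qed

end
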